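(* Let $A$ be a $C^*$-algebra, $X$ a Hilbert $A$-module, $\mathcal{H},\mathcal{K}$ Hilbert spaces, $\varphi:A\to L(\mathcal{H})$ a completely positive linear map and $\Phi:X\to L(\mathcal{H},\mathcal{K})$ a $\varphi$-map. Then: (1) for every $T\in K(X)$ and $z\in X$, $\Phi(T(z))=\phi_{\Phi,\varphi}(T)\Phi(z)$; (2) $K(X)X_\varphi\subseteq X_\varphi$. Moreover, if $\varphi$ is a contraction, then (3) for $x\in X$: $x\in X_\varphi$ if and only if $\phi_{\Phi,\varphi}(\theta_{x,x})=\Phi(x)\Phi(x)^*$; (4) for $x\in X$: $x\in X_\varphi$ if and only if $\phi_{\Phi,\varphi}(\theta_{x,y})=\Phi(x)\Phi(y)^*$ for all $y\in X$; (5) $\phi_{\Phi,\varphi}(\theta_{xa,y})=\Phi(xa)\Phi(y)^*=\Phi(x)\varphi(a)\Phi(y)^*$ for all $x,y\in X$ and $a\in T_\varphi$.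
   Context: Hilbert $C^*$-modules are right modules, with inner product linear in the second variable. $L(\mathcal{H},\mathcal{K})$ denotes bounded linear operators, $L(\mathcal{H})=L(\mathcal{H},\mathcal{H})$, and $[\,\cdot\,]$ closed linear span. A map $\Phi:X\to L(\mathcal{H},\mathcal{K})$ is a $\varphi$-map if $\Phi(x)^*\Phi(y)=\varphi(\langle x,y\rangle)$ for all $x,y\in X$; when $\varphi$ is a $*$-homomorphism it is called a $\varphi$-representation. $K(X)$ is the $C^*$-algebra of compact operators on $X$, the closed linear span of the operators $\theta_{x,y}(z)=x\langle y,z\rangle$. Let $M_\varphi=\{a\in A:\varphi(ab)=\varphi(a)\varphi(b),\ \varphi(ba)=\varphi(b)\varphi(a)\ \forall b\in A\}$ and $T_\varphi=\{a\in M_\varphi:\varphi(ba^*c)=\varphi(b)\varphi(a)^*\varphi(c)\ \forall b,c\in A\}$. The ternary domain $X_\varphi$ of $\varphi$ on $X$ is the set $\{x\in X:\Phi(xb)=\Phi(x)\varphi(b)\text{ for all }b\in A\}$, where $\Phi$ is any operator-valued $\varphi$-map on $X$ (the set is the same for every choice of $\Phi$; equivalently $X_\varphi=\{x\in X:\langle x,x\rangle\in T_\varphi\}$). A minimal Stinespring representation associated to $(\varphi,\Phi)$ consists of Hilbert spaces $\mathcal{H}',\mathcal{K}'$, a $*$-representation $\pi:A\to L(\mathcal{H}')$, a $\pi$-representation $\Pi:X\to L(\mathcal{H}',\mathcal{K}')$, a bounded operator $V:\mathcal{H}\to\mathcal{H}'$ and a coisometry $W:\mathcal{K}\to\mathcal{K}'$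 with $\varphi(\cdot)=V^*\pi(\cdot)V$, $[\pi(A)V\mathcal{H}]=\mathcal{H}'$, $\Phi(\cdot)=W^*\Pi(\cdot)V$, $[\Pi(X)V\mathcal{H}]=\mathcal{K}'$; such a representation exists. $\phi_{\Phi,\varphi}:K(X)\to L(\mathcal{K})$ is the $*$-representation determined by $\phi_{\Phi,\varphi}(\theta_{x,y})=W^*\Pi(x)\Pi(y)^*W$ for all $x,y\in X$ (independent of the choice of minimal Stinespring representation). *)

theory Defs
  imports "HOL-Analysis.Analysis"
begin

section \<open>Complex vector spaces, Hilbert spaces and C*-algebras\<close>

class complex_vector = real_vector +
  fixes scaleC :: "complex \<Rightarrow> 'a \<Rightarrow> 'a" (infixr "*\<^sub>C" 75)
  assumes scaleC_add_right: "c *\<^sub>C (x + y) = c *\<^sub>C x + c *\<^sub>C y"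
    and scaleC_add_left: "(c + d) *\<^sub>C x = c *\<^sub>C x + d *\<^sub>C x"
    and scaleC_scaleC: "c *\<^sub>C (d *\<^sub>C x) = (c * d) *\<^sub>C x"
    and scaleC_of_real: "complex_of_real r *\<^sub>C x = r *\<^sub>R x"

class complex_normed_vector = complex_vector + real_normed_vector +
  assumes norm_scaleC: "norm (c *\<^sub>C x) = cmod c * norm x"

text \<open>Inner products are linear in the second variable.\<close>

class complex_hilbert = complex_normed_vector + complete_space +
  fixes cinner :: "'a \<Rightarrow> 'a \<Rightarrow> complex"
  assumes cinner_add_right: "cinner x (y + z) = cinner x y + cinner x z"
    and cinner_scaleC_right: "cinner x (c *\<^sub>C y) = c * cinner x y"
    and cinner_commute: "cinner y x = cnj (cinner x y)"
    and cinner_self_nonneg: "cinner x x \<in> \<real>\<^sub>\<ge>\<^sub>0"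
    and norm_eq_sqrt_cinner: "norm x = sqrt (cmod (cinner x x))"

text \<open>C*-algebras are not assumed to be unital.\<close>

class cstar_algebra = complex_normed_vector + real_normed_algebra + complete_space +
  fixes star :: "'a \<Rightarrow> 'a"
  assumes mult_scaleC_left: "(c *\<^sub>C a) * b = c *\<^sub>C (a * b)"
    and mult_scaleC_right: "a * (c *\<^sub>C b) = c *\<^sub>C (a * b)"
    and star_add: "star (a + b) = star a + star b"
    and star_scaleC: "star (c *\<^sub>C a) = cnj c *\<^sub>C star a"
    and star_mult: "star (a * b) = star b * star a"
    and star_star: "star (star a) = a"
    and norm_star_mult_self: "norm (star a * a) = (norm a)\<^sup>2"

lemma scaleC_one: "1 *\<^sub>C (x::'a::complex_vector) = x"
  using scaleC_of_real[of 1 x] by simp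

lemma vector_space_scaleC: "vector_space (scaleC :: complex \<Rightarrow> 'a::complex_vector \<Rightarrow> 'a)"
  by standard (simp_all add: scaleC_add_right scaleC_add_left scaleC_scaleC scaleC_one)

abbreviation cspan :: "'a::complex_vector set \<Rightarrow> 'a set" where
  "cspan \<equiv> module.span scaleC"

abbreviation clinear :: "('a::complex_vector \<Rightarrow> 'b::complex_vector) \<Rightarrow> bool" where
  "clinear \<equiv> Vector_Spaces.linear scaleC scaleC"

definition closed_cspan :: "'a::complex_normed_vector set \<Rightarrow> 'a set" where
  "closed_cspan S = closure (cspan S)"


section \<open>Bounded operators\<close>

lemma bounded_linear_scaleC: "bounded_linear (\<lambda>x::'a::complex_normed_vector. c *\<^sub>C x)"
proof
  fix x y :: 'a and r :: real
  show "c *\<^sub>C (x + y) = c *\<^sub>C x + c *\<^sub>C y"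
    by (rule scaleC_add_right)
  show "c *\<^sub>C (r *\<^sub>R x) = r *\<^sub>R (c *\<^sub>C x)"
    by (simp add: scaleC_of_real[symmetric] scaleC_scaleC mult.commute)
  show "\<exists>K. \<forall>x::'a. norm (c *\<^sub>C x) \<le> norm x * K"
    by (rule exI[of _ "cmod c"]) (simp add: norm_scaleC mult.commute)
qed

instantiation blinfun :: (real_normed_vector, complex_normed_vector) complex_normed_vector
begin

lift_definition scaleC_blinfun :: "complex \<Rightarrow> 'a \<Rightarrow>\<^sub>L 'b \<Rightarrow> 'a \<Rightarrow>\<^sub>L 'b"
  is "\<lambda>c T x. c *\<^sub>C T x"
  by (rule bounded_linear_compose[OF bounded_linear_scaleC])

instance
proof
  fix c d :: complex and r :: real and S T :: "'a \<Rightarrow>\<^sub>L 'b"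
  show "c *\<^sub>C (S + T) = c *\<^sub>C S + c *\<^sub>C T"
    by transfer (simp add: scaleC_add_right)
  show "(c + d) *\<^sub>C T = c *\<^sub>C T + d *\<^sub>C T"
    by transfer (simp add: scaleC_add_left)
  show "c *\<^sub>C (d *\<^sub>C T) = (c * d) *\<^sub>C T"
    by transfer (simp add: scaleC_scaleC)
  show "complex_of_real r *\<^sub>C T = r *\<^sub>R T"
    by transfer (simp add: scaleC_of_real)
  have le: "norm (c *\<^sub>C T) \<le> cmod c * norm T" for c and T :: "'a \<Rightarrow>\<^sub>L 'b"
  proof (rule norm_blinfun_bound)
    fix x
    have "cmod c * norm (blinfun_apply T x) \<le> cmod c * (norm T * norm x)"
      by (intro mult_left_mono norm_blinfun) simp
    then show "norm (blinfun_apply (c *\<^sub>C T) x) \<le> cmod c * norm T * norm x"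
      by (simp add: scaleC_blinfun.rep_eq norm_scaleC mult.assoc)
  qed simp
  show "norm (c *\<^sub>C T) = cmod c * norm T"
  proof (cases "c = 0")
    case True
    then show ?thesis using le[of c T] by simp
  next
    case False
    have "inverse c *\<^sub>C (c *\<^sub>C T) = T"
      using False by transfer (simp add: scaleC_scaleC scaleC_one)
    then have "norm T \<le> cmod (inverse c) * norm (c *\<^sub>C T)"
      using le[of "inverse c" "c *\<^sub>C T"] by simp
    then have "cmod c * norm T \<le> norm (c *\<^sub>C T)"
      using False by (simp add: norm_inverse norm_divide field_simps)
    then show ?thesis using le[of c T] by simp
  qed
qed

end

text \<open>The type \<open>'h \<Rightarrow>\<^sub>L 'k\<close> consists of the bounded \<^emph>\<open>real\<close>-linear maps;
  the following subspace is $L(\mathcal{H},\mathcal{K})$.\<close>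

definition bounded_ops :: "('h::complex_normed_vector \<Rightarrow>\<^sub>L 'k::complex_normed_vector) set" where
  "bounded_ops = {T. clinear (blinfun_apply T)}"

definition adj :: "('h::complex_hilbert \<Rightarrow>\<^sub>L 'k::complex_hilbert) \<Rightarrow> 'k \<Rightarrow>\<^sub>L 'h" where
  "adj T = (THE S. \<forall>h k. cinner (blinfun_apply T h) k = cinner h (blinfun_apply S k))"

definition coisometry :: "('h::complex_hilbert \<Rightarrow>\<^sub>L 'k::complex_hilbert) \<Rightarrow> bool" where
  "coisometry W \<longleftrightarrow> W \<in> bounded_ops \<and> W o\<^sub>L adj W = id_blinfun"


section \<open>Completely positive maps and representations\<close>

definition star_positive :: "'a::cstar_algebra \<Rightarrow> bool" where
  "star_positive a \<longleftrightarrow> (\<exists>b. a = star b * b)"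

text \<open>A matrix in $M_n(A)$ is represented by its entries with indices below \<open>n\<close>.  It is positive
  in the C*-algebra $M_n(A)$ if it equals $B^*B$ for some $B \in M_n(A)$.\<close>

definition matrix_positive :: "nat \<Rightarrow> (nat \<Rightarrow> nat \<Rightarrow> 'a::cstar_algebra) \<Rightarrow> bool" where
  "matrix_positive n M \<longleftrightarrow>
     (\<exists>B. \<forall>i<n. \<forall>j<n. M i j = (\<Sum>k<n. star (B k i) * B k j))"

text \<open>An operator matrix in $M_n(L(\mathcal{H})) = L(\mathcal{H}^n)$ is positive if its quadratic
  form on $\mathcal{H}^n$ is.\<close>

definition op_matrix_positive :: "nat \<Rightarrow> (nat \<Rightarrow> nat \<Rightarrow> 'h::complex_hilbert \<Rightarrow>\<^sub>L 'h) \<Rightarrow> bool" where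
  "op_matrix_positive n M \<longleftrightarrow>
     (\<forall>h. (\<Sum>i<n. cinner (h i) (\<Sum>j<n. blinfun_apply (M i j) (h j))) \<in> \<real>\<^sub>\<ge>\<^sub>0)"

definition completely_positive :: "('a::cstar_algebra \<Rightarrow> 'h::complex_hilbert \<Rightarrow>\<^sub>L 'h) \<Rightarrow> bool" where
  "completely_positive \<phi> \<longleftrightarrow>
     range \<phi> \<subseteq> bounded_ops \<and> clinear \<phi> \<and>
     (\<forall>n M. matrix_positive n M \<longrightarrow> op_matrix_positive n (\<lambda>i j. \<phi> (M i j)))"

definition star_representation :: "('a::cstar_algebra \<Rightarrow> 'h::complex_hilbert \<Rightarrow>\<^sub>L 'h) \<Rightarrow> bool" where
  "star_representation \<pi> \<longleftrightarrow>
     range \<pi> \<subseteq> bounded_ops \<and> clinear \<pi> \<and>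
     (\<forall>a b. \<pi> (a * b) = \<pi> a o\<^sub>L \<pi> b) \<and> (\<forall>a. \<pi> (star a) = adj (\<pi> a))"

definition mult_domain :: "('a::cstar_algebra \<Rightarrow> 'h::complex_hilbert \<Rightarrow>\<^sub>L 'h) \<Rightarrow> 'a set" where
  "mult_domain \<phi> = {a. \<forall>b. \<phi> (a * b) = \<phi> a o\<^sub>L \<phi> b \<and> \<phi> (b * a) = \<phi> b o\<^sub>L \<phi> a}"

definition ternary_mult_domain ::
  "('a::cstar_algebra \<Rightarrow> 'h::complex_hilbert \<Rightarrow>\<^sub>L 'h) \<Rightarrow> 'a set" where
  "ternary_mult_domain \<phi> =
     {a \<in> mult_domain \<phi>. \<forall>b c. \<phi> (b * star a * c) = \<phi> b o\<^sub>L adj (\<phi> a) o\<^sub>L \<phi> c}"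


section \<open>Hilbert C*-modules\<close>

text \<open>Right Hilbert modules: \<open>act x a\<close> is $xa$ and \<open>ip x y\<close> is $\langle x,y\rangle$.  The norm of the
  type \<open>'x\<close> is the module norm, and completeness of \<open>'x\<close> is part of its sort.\<close>

locale hilbert_module =
  fixes act :: "'x::{complex_normed_vector, complete_space} \<Rightarrow> 'a::cstar_algebra \<Rightarrow> 'x"
    and ip :: "'x \<Rightarrow> 'x \<Rightarrow> 'a"
  assumes act_add_left: "act (x + y) a = act x a + act y a"
    and act_add_right: "act x (a + b) = act x a + act x b"
    and act_mult: "act x (a * b) = act (act x a) b"
    and act_scaleC_left: "act (c *\<^sub>C x) a = c *\<^sub>C act x a"
    and act_scaleC_right: "act x (c *\<^sub>C a) = c *\<^sub>C act x a"
    and ip_add_right: "ip x (y + z) = ip x y + ip x z"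
    and ip_scaleC_right: "ip x (c *\<^sub>C y) = c *\<^sub>C ip x y"
    and ip_act_right: "ip x (act y a) = ip x y * a"
    and ip_commute: "ip y x = star (ip x y)"
    and ip_self_positive: "star_positive (ip x x)"
    and ip_self_eq_0: "ip x x = 0 \<Longrightarrow> x = 0"
    and norm_eq_sqrt_ip: "norm x = sqrt (norm (ip x x))"

definition rank_one_op ::
  "('x::complex_normed_vector \<Rightarrow> 'a::cstar_algebra \<Rightarrow> 'x) \<Rightarrow> ('x \<Rightarrow> 'x \<Rightarrow> 'a) \<Rightarrow> 'x \<Rightarrow> 'x \<Rightarrow> 'x \<Rightarrow>\<^sub>L 'x" where
  "rank_one_op act ip x y = Blinfun (\<lambda>z. act x (ip y z))"

definition compact_ops ::
  "('x::complex_normed_vector \<Rightarrow> 'a::cstar_algebra \<Rightarrow> 'x) \<Rightarrow> ('x \<Rightarrow> 'x \<Rightarrow> 'a) \<Rightarrow> ('x \<Rightarrow>\<^sub>L 'x) set" where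
  "compact_ops act ip = closed_cspan {rank_one_op act ip x y | x y. True}"

definition op_valued_map ::
  "('x \<Rightarrow> 'x \<Rightarrow> 'a::cstar_algebra) \<Rightarrow> ('a \<Rightarrow> 'h::complex_hilbert \<Rightarrow>\<^sub>L 'h) \<Rightarrow>
   ('x \<Rightarrow> 'h \<Rightarrow>\<^sub>L 'k::complex_hilbert) \<Rightarrow> bool" where
  "op_valued_map ip \<phi> \<Phi> \<longleftrightarrow>
     range \<Phi> \<subseteq> bounded_ops \<and> (\<forall>x y. adj (\<Phi> x) o\<^sub>L \<Phi> y = \<phi> (ip x y))"

text \<open>The ternary domain $X_\varphi$, computed with a given \<open>\<phi>\<close>-map \<open>\<Phi>\<close>.\<close>

definition ternary_domain ::
  "('x \<Rightarrow> 'a::cstar_algebra \<Rightarrow> 'x) \<Rightarrow> ('a \<Rightarrow> 'h::complex_hilbert \<Rightarrow>\<^sub>L 'h) \<Rightarrow>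
   ('x \<Rightarrow> 'h \<Rightarrow>\<^sub>L 'k::complex_hilbert) \<Rightarrow> 'x set" where
  "ternary_domain act \<phi> \<Phi> = {x. \<forall>b. \<Phi> (act x b) = \<Phi> x o\<^sub>L \<phi> b}"

definition minimal_stinespring ::
  "('x \<Rightarrow> 'x \<Rightarrow> 'a::cstar_algebra) \<Rightarrow>
   ('a \<Rightarrow> 'h::complex_hilbert \<Rightarrow>\<^sub>L 'h) \<Rightarrow> ('x \<Rightarrow> 'h \<Rightarrow>\<^sub>L 'k::complex_hilbert) \<Rightarrow>
   ('a \<Rightarrow> 'h1::complex_hilbert \<Rightarrow>\<^sub>L 'h1) \<Rightarrow> ('x \<Rightarrow> 'h1 \<Rightarrow>\<^sub>L 'k1::complex_hilbert) \<Rightarrow>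
   ('h \<Rightarrow>\<^sub>L 'h1) \<Rightarrow> ('k \<Rightarrow>\<^sub>L 'k1) \<Rightarrow> bool" where
  "minimal_stinespring ip \<phi> \<Phi> \<pi> \<Pi>\<^sub>X V W \<longleftrightarrow>
     star_representation \<pi> \<and> op_valued_map ip \<pi> \<Pi>\<^sub>X \<and> V \<in> bounded_ops \<and> coisometry W \<and>
     (\<forall>a. \<phi> a = adj V o\<^sub>L \<pi> a o\<^sub>L V) \<and>
     closed_cspan {blinfun_apply (\<pi> a) (blinfun_apply V h) | a h. True} = UNIV \<and>
     (\<forall>x. \<Phi> x = adj W o\<^sub>L \<Pi>\<^sub>X x o\<^sub>L V) \<and>
     closed_cspan {blinfun_apply (\<Pi>\<^sub>X x) (blinfun_apply V h) | x h. True} = UNIV"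

text \<open>A *-representation of $K(X)$ is only constrained on the set \<open>compact_ops act ip\<close>.
  The involution of $K(X)$ is the adjoint with respect to the \<open>'a\<close>-valued inner product.\<close>

definition compact_star_representation ::
  "('x::complex_normed_vector \<Rightarrow> 'a::cstar_algebra \<Rightarrow> 'x) \<Rightarrow> ('x \<Rightarrow> 'x \<Rightarrow> 'a) \<Rightarrow>
   (('x \<Rightarrow>\<^sub>L 'x) \<Rightarrow> 'k::complex_hilbert \<Rightarrow>\<^sub>L 'k) \<Rightarrow> bool" where
  "compact_star_representation act ip \<psi> \<longleftrightarrow>
     \<psi> ` compact_ops act ip \<subseteq> bounded_ops \<and>
     (\<forall>S\<in>compact_ops act ip. \<forall>T\<in>compact_ops act ip. \<psi> (S + T) = \<psi> S + \<psi> T) \<and>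
     (\<forall>c. \<forall>T\<in>compact_ops act ip. \<psi> (c *\<^sub>C T) = c *\<^sub>C \<psi> T) \<and>
     (\<forall>S\<in>compact_ops act ip. \<forall>T\<in>compact_ops act ip. \<psi> (S o\<^sub>L T) = \<psi> S o\<^sub>L \<psi> T) \<and>
     (\<forall>S\<in>compact_ops act ip. \<forall>T\<in>compact_ops act ip.
        (\<forall>x y. ip (blinfun_apply T x) y = ip x (blinfun_apply S y)) \<longrightarrow> \<psi> S = adj (\<psi> T))"

text \<open>The *-representation $\phi_{\Phi,\varphi}$ of $K(X)$, obtained from the parts \<open>\<Pi>\<^sub>X\<close> and \<open>W\<close> of a
  minimal Stinespring representation.  Membership in \<^const>\<open>extensional\<close> merely fixes the irrelevant
  values outside $K(X)$, so that the description is definite.\<close>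

definition induced_rep ::
  "('x::complex_normed_vector \<Rightarrow> 'a::cstar_algebra \<Rightarrow> 'x) \<Rightarrow> ('x \<Rightarrow> 'x \<Rightarrow> 'a) \<Rightarrow>
   ('x \<Rightarrow> 'h1::complex_hilbert \<Rightarrow>\<^sub>L 'k1::complex_hilbert) \<Rightarrow> ('k::complex_hilbert \<Rightarrow>\<^sub>L 'k1) \<Rightarrow>
   ('x \<Rightarrow>\<^sub>L 'x) \<Rightarrow> 'k \<Rightarrow>\<^sub>L 'k" where
  "induced_rep act ip \<Pi>\<^sub>X W =
     (THE \<psi>. \<psi> \<in> extensional (compact_ops act ip) \<and> compact_star_representation act ip \<psi> \<and>
        (\<forall>x y. \<psi> (rank_one_op act ip x y) = adj W o\<^sub>L \<Pi>\<^sub>X x o\<^sub>L adj (\<Pi>\<^sub>X y) o\<^sub>L W))"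

end

theory Submission
  imports Defs
begin

text \<open>
  Write \<open>R = V V\<^sup>*\<close>.  Everything takes place in the minimal Stinespring representation, where
  \<open>\<Phi> x = W\<^sup>* \<Pi>(x) V\<close>, \<open>\<phi> a = V\<^sup>* \<pi>(a) V\<close> and \<open>W\<^sup>*\<close> is isometric.

  The representation \<open>\<psi>\<close> of the compact operators is \<open>W\<^sup>* \<rho>(T) W\<close>, where \<open>\<rho>(T)\<close> is the operator
  with \<open>\<rho>(T) \<Pi>(z) h = \<Pi>(T z) h\<close>.  The vectors \<open>\<Pi>(z) h\<close> are total, so \<open>\<rho>(T)\<close> is unique, and all
  algebraic identities for \<open>\<rho>\<close> are read off from that formula.  Since \<open>W W\<^sup>* = 1\<close>, the first claim
  \<open>\<Phi>(T z) = \<psi>(T) \<Phi>(z)\<close> is immediate.  By totality of the vectors \<open>\<pi>(a) V h\<close>, an element \<open>x\<close> lies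
  in the ternary domain iff \<open>\<Pi>(x) = \<Pi>(x) R\<close> (\<open>ternary_domain_iff\<close>), a condition preserved by
  \<open>\<Pi>(T x) = \<rho>(T) \<Pi>(x)\<close>; this is the second claim.  As \<open>\<psi>(\<theta>\<^sub>x\<^sub>y) = W\<^sup>* \<Pi>(x) \<Pi>(y)\<^sup>* W\<close> and
  \<open>\<Phi>(x) \<Phi>(y)\<^sup>* = W\<^sup>* \<Pi>(x) R \<Pi>(y)\<^sup>* W\<close>, the same criterion gives the forward directions of the third
  and fourth claims.  Conversely, \<open>\<Pi>(x) (1 - R) \<Pi>(x)\<^sup>* = 0\<close> forces \<open>\<Pi>(x) (1 - R) = 0\<close> as soon as
  \<open>1 - R\<close> is positive, that is, \<open>V\<close> is a contraction.  Finally, \<open>a\<close> in the ternary multiplicative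
  domain satisfies \<open>R \<pi>(a) = \<pi>(a) = \<pi>(a) R\<close> (\<open>ternary_mult_domain_rep\<close>), so
  \<open>\<Pi>(x a) = \<Pi>(x) \<pi>(a)\<close> meets the criterion.

  Two points need C*-algebra theory, and both rest on one elementary device, a solution \<open>s = s\<^sup>*\<close> of
  \<open>2 s - s s = d\<close> for \<open>d = d\<^sup>*\<close> with \<open>\<parallel>d\<parallel> < 1\<close>, which says \<open>(1 - s)\<^sup>2 = 1 - d\<close> and is found by
  Banach's fixed point theorem (\<open>quadratic_equation_solution\<close>).

  The first point is that \<open>\<psi>\<close> exists and is unique.  With \<open>d = T\<^sup>* T\<close>, the identity
  \<open>\<parallel>h\<parallel>\<^sup>2 - \<parallel>\<psi>(T) h\<parallel>\<^sup>2 = \<parallel>(1 - \<psi>(s)) h\<parallel>\<^sup>2\<close> bounds every *-representation of the compact operators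
  (\<open>norm_compact_rep_le\<close>), whence uniqueness; a variant of it bounds \<open>\<rho>(T)\<close> in terms of \<open>T\<close>
  (\<open>implements_norm_le\<close>), so that the operators \<open>T\<close> for which \<open>\<rho>(T)\<close> exists form a closed subspace
  containing all \<open>\<theta>\<^sub>x\<^sub>y\<close>.  Constants are irrelevant here, so the polarization bound
  \<open>\<parallel>\<langle>x, y\<rangle>\<parallel> \<le> 4 \<parallel>x\<parallel> \<parallel>y\<parallel>\<close> can replace the Cauchy--Schwarz inequality of Hilbert modules.

  The second point is that \<open>V\<close> is a contraction when \<open>\<phi>\<close> is.  In a unital algebra \<open>V\<^sup>* V = \<phi>(1)\<close>; in
  general one needs \<open>b\<close> with \<open>\<parallel>b\<parallel> \<le> 1\<close> and \<open>\<pi>(b) V h\<close> close to \<open>V h\<close>.  If \<open>S\<close> is a self-adjoint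
  contraction on a Hilbert module, then \<open>S + i (1 - S\<^sup>2)\<^sup>1\<^sup>/\<^sup>2\<close> is unitary, hence
  \<open>\<parallel>1 - S\<^sup>2\<parallel> \<le> 1\<close> (\<open>norm_one_minus_square_le\<close>).  For the algebra as a module over itself this shows
  that \<open>1 - d\<^sup>2\<close> acts contractively for \<open>d = d\<^sup>*\<close>, \<open>\<parallel>d\<parallel> \<le> 1\<close>.  Products of such factors can be made to
  annihilate \<open>V h\<close> approximately, and \<open>1 - (w\<^sup>* w)\<^sup>2\<close> for such a product \<open>w\<close> is the desired \<open>b\<close>
  (\<open>contractive_approximate_unit\<close>).
\<close>


section \<open>Complex normed spaces\<close>

instance complex_hilbert \<subseteq> banach ..

instance cstar_algebra \<subseteq> banach ..

text \<open>The usual pointwise limit argument, for exactly the sort that a Hilbert module carries, so that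
  fixed points and closed graphs are available for operators on it.\<close>

instance blinfun :: (real_normed_vector, "{real_normed_vector, complete_space}") complete_space
proof
  fix X :: "nat \<Rightarrow> 'a \<Rightarrow>\<^sub>L 'b"
  assume X: "Cauchy X"
  have "\<exists>l. (\<lambda>n. X n x) \<longlonglongrightarrow> l" for x
    using Cauchy_convergent[OF bounded_linear.Cauchy[OF blinfun.bounded_linear_left[of x] X]]
    by (simp add: convergent_def)
  then obtain L where L: "(\<lambda>n. X n x) \<longlonglongrightarrow> L x" for x
    by metis
  from Cauchy_Bseq[OF X] obtain K where K: "K > 0" "\<And>n. norm (X n) \<le> K"
    unfolding Bseq_def by auto
  have lin: "bounded_linear L"
  proof
    fix x y r
    show "L (x + y) = L x + L y"
      using tendsto_add[OF L[of x] L[of y]] L[of "x + y"]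
      by (auto simp: blinfun.add_right intro: LIMSEQ_unique)
    show "L (r *\<^sub>R x) = r *\<^sub>R L x"
      using tendsto_scaleR[OF tendsto_const L[of x], of r] L[of "r *\<^sub>R x"]
      by (auto simp: blinfun.scaleR_right intro: LIMSEQ_unique)
    have "norm (L x) \<le> norm x * K" for x
    proof (rule tendsto_upperbound[OF tendsto_norm[OF L]])
      have "norm (X n x) \<le> norm x * K" for n
        using order_trans[OF norm_blinfun[of "X n" x] mult_right_mono[OF K(2), of "norm x"]]
        by (simp add: mult.commute)
      then show "\<forall>\<^sub>F n in sequentially. norm (X n x) \<le> norm x * K" by simp
    qed simp
    then show "\<exists>K. \<forall>x. norm (L x) \<le> norm x * K" by blast
  qed
  define T where "T = Blinfun L"
  have T: "blinfun_apply T x = L x" for x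
    unfolding T_def by (simp add: bounded_linear_Blinfun_apply lin)
  have "X \<longlonglongrightarrow> T"
  proof (rule LIMSEQ_I)
    fix r :: real assume "0 < r"
    then obtain N where N: "\<And>m n. m \<ge> N \<Longrightarrow> n \<ge> N \<Longrightarrow> norm (X m - X n) < r / 2"
      using CauchyD[OF X, of "r/2"] by auto
    have "norm (X n - T) \<le> r / 2" if "n \<ge> N" for n
    proof (rule norm_blinfun_bound)
      fix x
      have "(\<lambda>m. norm (X n x - X m x)) \<longlonglongrightarrow> norm (X n x - L x)"
        by (intro tendsto_intros L)
      moreover have "\<forall>\<^sub>F m in sequentially. norm (X n x - X m x) \<le> r / 2 * norm x"
        using eventually_ge_at_top[of N]
      proof eventually_elim
        case (elim m)
        have "norm ((X n - X m) x) \<le> norm (X n - X m) * norm x" by (rule norm_blinfun)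
        also have "\<dots> \<le> r / 2 * norm x"
          using N[OF that elim] by (intro mult_right_mono) auto
        finally show ?case by (simp add: blinfun.diff_left)
      qed
      ultimately show "norm ((X n - T) x) \<le> r / 2 * norm x"
        unfolding blinfun.diff_left T by (rule tendsto_upperbound) simp
    qed (use \<open>0 < r\<close> in simp)
    moreover have "r / 2 < r" using \<open>0 < r\<close> by simp
    ultimately show "\<exists>no. \<forall>n\<ge>no. norm (X n - T) < r"
      using order_le_less_trans by blast
  qed
  then show "convergent X" by (rule convergentI)
qed

lemma module_scaleC: "module (scaleC :: complex \<Rightarrow> 'a \<Rightarrow> 'a::complex_vector)"
  using vector_space_scaleC unfolding vector_space_def module_def .

abbreviation csubspace :: "'a::complex_vector set \<Rightarrow> bool" where
  "csubspace \<equiv> module.subspace scaleC"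

lemma csubspaceI:
  assumes "0 \<in> S" "\<And>x y. x \<in> S \<Longrightarrow> y \<in> S \<Longrightarrow> x + y \<in> S" "\<And>c x. x \<in> S \<Longrightarrow> c *\<^sub>C x \<in> S"
  shows "csubspace S"
  using assms by (simp add: module.subspace_def[OF module_scaleC])

lemma scaleR_eq_scaleC: "r *\<^sub>R x = complex_of_real r *\<^sub>C x"
  by (simp add: scaleC_of_real)

lemma scaleC_zero_right [simp]: "c *\<^sub>C 0 = (0::'a::complex_vector)"
  using scaleC_add_right[of c 0 "0::'a"] by simp

lemma scaleC_minus_one [simp]: "(- 1) *\<^sub>C x = - (x::'a::complex_vector)"
  using scaleC_of_real[of "-1" x] by simp

lemma scaleC_minus_right: "c *\<^sub>C (- x) = - (c *\<^sub>C (x::'a::complex_vector))"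
  using minus_unique[of "c *\<^sub>C x" "c *\<^sub>C (- x)"] scaleC_add_right[of c x "- x"] by simp

lemma scaleC_diff_right: "c *\<^sub>C (x - y) = c *\<^sub>C x - c *\<^sub>C (y::'a::complex_vector)"
  using scaleC_add_right[of c x "- y"] by (simp add: scaleC_minus_right)

lemma csubspace_0: "csubspace S \<Longrightarrow> 0 \<in> S"
  and csubspace_add: "csubspace S \<Longrightarrow> x \<in> S \<Longrightarrow> y \<in> S \<Longrightarrow> x + y \<in> S"
  and csubspace_scaleC: "csubspace S \<Longrightarrow> x \<in> S \<Longrightarrow> c *\<^sub>C x \<in> S"
  by (simp_all add: module.subspace_def[OF module_scaleC])

lemma csubspace_diff: "csubspace S \<Longrightarrow> x \<in> S \<Longrightarrow> y \<in> S \<Longrightarrow> x - y \<in> S"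
  using csubspace_add[of S x "(-1) *\<^sub>C y"] csubspace_scaleC[of S y "-1"] by simp

lemma csubspace_scaleR: "csubspace S \<Longrightarrow> x \<in> S \<Longrightarrow> r *\<^sub>R x \<in> S"
  unfolding scaleR_eq_scaleC by (rule csubspace_scaleC)

lemma closed_cspan_minimal:
  assumes "S \<subseteq> C" "csubspace C" "closed C"
  shows "closed_cspan S \<subseteq> C"
  unfolding closed_cspan_def
  by (rule closure_minimal[OF module.span_minimal[OF module_scaleC assms(1,2)] assms(3)])

lemma closed_cspan_superset: "S \<subseteq> closed_cspan S"
  unfolding closed_cspan_def
  by (rule order_trans[OF module.span_superset[OF module_scaleC] closure_subset])

lemma closed_closed_cspan: "closed (closed_cspan S)"
  by (simp add: closed_cspan_def)

lemma csubspace_closed_cspan: "csubspace (closed_cspan S)"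
proof (rule csubspaceI)
  have sub: "csubspace (cspan S)" by (rule module.subspace_span[OF module_scaleC])
  show "0 \<in> closed_cspan S"
    unfolding closed_cspan_def using csubspace_0[OF sub] closure_subset by blast
  fix x y assume "x \<in> closed_cspan S" "y \<in> closed_cspan S"
  then obtain f g where fg: "\<And>n. f n \<in> cspan S" "f \<longlonglongrightarrow> x" "\<And>n. g n \<in> cspan S" "g \<longlonglongrightarrow> y"
    unfolding closed_cspan_def closure_sequential by blast
  have "\<forall>n. f n + g n \<in> cspan S"
    using csubspace_add[OF sub fg(1) fg(3)] by blast
  moreover have "(\<lambda>n. f n + g n) \<longlonglongrightarrow> x + y"
    by (rule tendsto_add[OF fg(2) fg(4)])
  ultimately show "x + y \<in> closed_cspan S"
    unfolding closed_cspan_def closure_sequential by (intro exI[of _ "\<lambda>n. f n + g n"]) simp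
  fix c
  have "\<forall>n. c *\<^sub>C f n \<in> cspan S"
    using csubspace_scaleC[OF sub fg(1)] by blast
  moreover have "(\<lambda>n. c *\<^sub>C f n) \<longlonglongrightarrow> c *\<^sub>C x"
    by (rule bounded_linear.tendsto[OF bounded_linear_scaleC fg(2)])
  ultimately show "c *\<^sub>C x \<in> closed_cspan S"
    unfolding closed_cspan_def closure_sequential by (intro exI[of _ "\<lambda>n. c *\<^sub>C f n"]) simp
qed

text \<open>Pairs of vectors carry only their real linear structure here.  This lets graphs, which are subspaces
  of a product, be compared with complex spans.\<close>

lemma cspan_eq_real_span:
  assumes "\<And>c x. x \<in> S \<Longrightarrow> c *\<^sub>C x \<in> S"
  shows "cspan S = span S"
proof
  have "c *\<^sub>C x \<in> span S" if "x \<in> span S" for c x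
    using that
  proof (induction rule: span_induct_alt)
    case base
    then show ?case by (simp add: span_zero)
  next
    case (step r x y)
    have "c *\<^sub>C (r *\<^sub>R x + y) = r *\<^sub>R (c *\<^sub>C x) + c *\<^sub>C y"
      unfolding scaleR_eq_scaleC scaleC_add_right scaleC_scaleC by (simp only: mult.commute)
    then show ?case
      using step by (metis assms span_add span_scale span_base)
  qed
  then show "cspan S \<subseteq> span S"
    by (intro module.span_minimal[OF module_scaleC] csubspaceI)
       (auto intro: span_zero span_add span_base)
  have "subspace (cspan S)"
    using module.subspace_span[OF module_scaleC, of S]
    by (intro subspaceI csubspace_0 csubspace_add csubspace_scaleR)
  then show "span S \<subseteq> cspan S"
    by (rule span_minimal[OF module.span_superset[OF module_scaleC]])
qed

text \<open>Applied to differences, the bound makes the second components of a sequence converge together with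
  the first ones.  Extension by density becomes the statement that the domain is closed.\<close>

lemma closed_domain_of_bounded_graph:
  fixes P :: "('a::real_normed_vector \<times> 'b::{real_normed_vector, complete_space}) set"
  assumes "closed P" and diff: "\<And>p q. p \<in> P \<Longrightarrow> q \<in> P \<Longrightarrow> p - q \<in> P"
    and bound: "\<And>u v. (u, v) \<in> P \<Longrightarrow> norm v \<le> C * norm u"
  shows "closed (fst ` P)"
  unfolding closed_sequential_limits
proof (intro allI impI, elim conjE)
  fix u l assume u: "\<forall>n. u n \<in> fst ` P" and lim: "u \<longlonglongrightarrow> l"
  then have "\<forall>n. \<exists>v. (u n, v) \<in> P" by force
  then obtain v where v: "\<And>n. (u n, v n) \<in> P" by metis
  have bd: "norm (v m - v n) \<le> (\<bar>C\<bar> + 1) * norm (u m - u n)" for m n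
  proof -
    have "norm (v m - v n) \<le> C * norm (u m - u n)"
      using bound diff[OF v v, of m n] by simp
    also have "\<dots> \<le> (\<bar>C\<bar> + 1) * norm (u m - u n)"
      by (intro mult_right_mono) auto
    finally show ?thesis .
  qed
  have "Cauchy v"
  proof (rule CauchyI)
    fix e :: real assume "0 < e"
    then obtain M where M: "\<And>m n. m \<ge> M \<Longrightarrow> n \<ge> M \<Longrightarrow> norm (u m - u n) < e / (\<bar>C\<bar> + 1)"
      using CauchyD[OF LIMSEQ_imp_Cauchy[OF lim], of "e / (\<bar>C\<bar> + 1)"] by auto
    have "norm (v m - v n) < e" if "m \<ge> M" "n \<ge> M" for m n
      using bd[of m n] M[OF that] by (simp add: field_simps)
    then show "\<exists>M. \<forall>m\<ge>M. \<forall>n\<ge>M. norm (v m - v n) < e" by blast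
  qed
  then obtain w where "v \<longlonglongrightarrow> w"
    using Cauchy_convergent convergentD by metis
  have "(l, w) \<in> P"
    by (rule closed_sequentially[OF \<open>closed P\<close> v tendsto_Pair[OF lim \<open>v \<longlonglongrightarrow> w\<close>]])
  then show "l \<in> fst ` P" by force
qed

text \<open>Homogeneity turns a bound on a ball into a linear bound, without a case distinction at the zero
  vector.\<close>

lemma bound_by_scaling:
  fixes x :: "'a::real_normed_vector" and y c :: real
  assumes "c > 0" "y \<ge> 0" and "\<And>r. r > 0 \<Longrightarrow> r * norm x < c \<Longrightarrow> r * y \<le> b"
  shows "c * y \<le> b * norm x"
proof -
  have "c * y \<le> b * t" if "norm x < t" for t
  proof -
    have "t > 0" using that norm_ge_zero[of x] by linarith
    then have "c / t * y \<le> b"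
      using assms(3)[of "c / t"] \<open>c > 0\<close> that by (simp add: field_simps)
    then show ?thesis using \<open>t > 0\<close> by (simp add: field_simps)
  qed
  moreover have "b \<ge> 0"
  proof -
    have "b \<ge> c / (norm x + c) * y"
    proof (rule assms(3))
      show "c / (norm x + c) > 0" using \<open>c > 0\<close> by (simp add: add_nonneg_pos)
      have "norm x / (norm x + c) < 1"
        using \<open>c > 0\<close> by (simp add: add_nonneg_pos)
      then show "c / (norm x + c) * norm x < c"
        using mult_strict_left_mono[of "norm x / (norm x + c)" 1 c] \<open>c > 0\<close> by simp
    qed
    moreover have "c / (norm x + c) * y \<ge> 0" using assms by simp
    ultimately show ?thesis by linarith
  qed
  show ?thesis
  proof (rule field_le_epsilon)
    fix e :: real assume "0 < e"
    have "norm x < norm x + e / (b + 1)" using \<open>0 < e\<close> \<open>b \<ge> 0\<close> by simp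
    then have "c * y \<le> b * (norm x + e / (b + 1))" using calculation by blast
    also have "\<dots> = b * norm x + e * (b / (b + 1))" by (simp add: field_simps)
    also have "\<dots> \<le> b * norm x + e * 1"
      using \<open>0 < e\<close> \<open>b \<ge> 0\<close> by (intro add_left_mono mult_left_mono) auto
    finally show "c * y \<le> b * norm x + e" by simp
  qed
qed

section \<open>A quadratic equation in Banach algebras\<close>

text \<open>A self-adjoint square root \<open>1 - s\<close> of \<open>1 - d\<close> that avoids a unit: \<open>s \<mapsto> (d + s s) / 2\<close> maps the ball
  of radius \<open>r = 1 - sqrt (1 - \<parallel>d\<parallel>)\<close> into itself and is Lipschitz there with constant \<open>r < 1\<close>.  The
  closed set \<open>C\<close> passes properties such as self-adjointness, compactness or commutation with a given
  operator on to the solution.\<close>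

lemma quadratic_equation_solution:
  fixes p :: "'b::{real_normed_vector, complete_space} \<Rightarrow> 'b \<Rightarrow> 'b"
  assumes p: "bounded_bilinear p" and submult: "\<And>a b. norm (p a b) \<le> norm a * norm b"
    and C: "closed C" "0 \<in> C" "\<And>s. s \<in> C \<Longrightarrow> (1/2) *\<^sub>R (d + p s s) \<in> C"
    and d: "norm d < 1"
  shows "\<exists>s\<in>C. 2 *\<^sub>R s - p s s = d"
proof -
  interpret p: bounded_bilinear p by (rule p)
  \<comment> \<open>The smaller root of \<open>(norm d + r\<^sup>2) / 2 = r\<close>, which lies below 1 because \<open>norm d < 1\<close>.\<close>
  define r where "r = 1 - sqrt (1 - norm d)"
  have r: "0 \<le> r" "r < 1" "norm d + r\<^sup>2 = 2 * r"
    using d by (auto simp: r_def power2_eq_square algebra_simps)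
  define f where "f = (\<lambda>s. (1/2) *\<^sub>R (d + p s s))"
  define S where "S = C \<inter> cball 0 r"
  have "\<exists>!s\<in>S. f s = s"
  proof (rule Banach_fix[of S r])
    show "complete S"
      unfolding S_def using C(1) by (intro closed_Int closed_cball complete_eq_closed[THEN iffD2])
    show "S \<noteq> {}" using C(2) r(1) by (auto simp: S_def)
    show "f ` S \<subseteq> S"
    proof
      fix y assume "y \<in> f ` S"
      then obtain s where s: "s \<in> C" "norm s \<le> r" "y = f s" by (auto simp: S_def)
      have "norm (d + p s s) \<le> norm d + r * r"
        using submult[of s s] mult_mono[OF s(2) s(2)] r(1) norm_triangle_ineq[of d "p s s"]
        by simp
      then have "norm y \<le> r" using s(3) r(3) by (simp add: f_def power2_eq_square)
      then show "y \<in> S" using C(3)[OF s(1)] s(3) by (simp add: S_def f_def)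
    qed
    fix x y assume "x \<in> S" "y \<in> S"
    then have xy: "norm x \<le> r" "norm y \<le> r" by (auto simp: S_def)
    have "f x - f y = (1/2) *\<^sub>R (p x (x - y) + p (x - y) y)"
      by (simp add: f_def p.diff_left p.diff_right algebra_simps)
    also have "norm \<dots> \<le> (1/2) * (norm x * norm (x - y) + norm (x - y) * norm y)"
      using norm_triangle_ineq[of "p x (x - y)" "p (x - y) y"] submult[of x "x - y"]
        submult[of "x - y" y] by simp
    also have "\<dots> \<le> (1/2) * (r * norm (x - y) + norm (x - y) * r)"
      using xy by (intro mult_left_mono add_mono mult_right_mono) auto
    finally show "dist (f x) (f y) \<le> r * dist x y" by (simp add: dist_norm)
  qed (use r in auto)
  then obtain s where "s \<in> C" "f s = s" by (auto simp: S_def)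
  have "2 *\<^sub>R s = 2 *\<^sub>R f s" using \<open>f s = s\<close> by simp
  also have "\<dots> = d + p s s" by (simp add: f_def)
  finally have "2 *\<^sub>R s = d + p s s" .
  then have "2 *\<^sub>R s - p s s = d" by simp
  then show ?thesis using \<open>s \<in> C\<close> by blast
qed


section \<open>Complex Hilbert spaces\<close>

lemma cinner_add_left: "cinner (x + y) z = cinner x z + cinner y (z::'a::complex_hilbert)"
  by (metis cinner_add_right cinner_commute complex_cnj_add)

lemma cinner_scaleC_left: "cinner (c *\<^sub>C x) y = cnj c * cinner x (y::'a::complex_hilbert)"
  by (metis cinner_scaleC_right cinner_commute complex_cnj_mult)

lemma cinner_self: "cinner x x = complex_of_real ((norm x)\<^sup>2)" for x :: "'a::complex_hilbert"
proof -
  obtain r where r: "cinner x x = complex_of_real r" "r \<ge> 0"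
    using cinner_self_nonneg[of x] by (auto simp: nonneg_Reals_def)
  then show ?thesis using norm_eq_sqrt_cinner[of x] by simp
qed

lemma cinner_zero_right [simp]: "cinner x 0 = 0" for x :: "'a::complex_hilbert"
  using cinner_add_right[of x 0 0] by simp

lemma cinner_zero_left [simp]: "cinner 0 x = 0" for x :: "'a::complex_hilbert"
  using cinner_add_left[of 0 0 x] by simp

lemma cinner_minus_right: "cinner x (- y) = - cinner x y" for x :: "'a::complex_hilbert"
  using minus_unique[of "cinner x y" "cinner x (- y)"] cinner_add_right[of x y "- y"] by simp

lemma cinner_minus_left: "cinner (- x) y = - cinner x y" for x :: "'a::complex_hilbert"
  using minus_unique[of "cinner x y" "cinner (- x) y"] cinner_add_left[of x "- x" y] by simp

lemma cinner_diff_right: "cinner x (y - z) = cinner x y - cinner x z" for x :: "'a::complex_hilbert"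
  using cinner_add_right[of x y "- z"] by (simp add: cinner_minus_right)

lemma cinner_diff_left: "cinner (x - y) z = cinner x z - cinner y z" for x :: "'a::complex_hilbert"
  using cinner_add_left[of x "- y" z] by (simp add: cinner_minus_left)

lemma cinner_scaleR_right: "cinner x (r *\<^sub>R y) = of_real r * cinner x y"
  for x :: "'a::complex_hilbert"
  unfolding scaleR_eq_scaleC by (rule cinner_scaleC_right)

lemma cinner_scaleR_left: "cinner (r *\<^sub>R x) y = of_real r * cinner x y"
  for x :: "'a::complex_hilbert"
  unfolding scaleR_eq_scaleC by (simp add: cinner_scaleC_left)

lemma Re_cinner_commute: "Re (cinner y x) = Re (cinner x y)" for x :: "'a::complex_hilbert"
  using cinner_commute[of y x] by simp

lemma norm_add_square: "(norm (x + y))\<^sup>2 = (norm x)\<^sup>2 + 2 * Re (cinner x y) + (norm y)\<^sup>2"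
  for x :: "'a::complex_hilbert"
proof -
  have "complex_of_real ((norm (x + y))\<^sup>2) = cinner x x + cinner y x + cinner x y + cinner y y"
    unfolding cinner_self[symmetric] cinner_add_left cinner_add_right by simp
  from arg_cong[OF this, of Re] show ?thesis
    by (simp add: cinner_self Re_cinner_commute[of y x])
qed

lemma norm_diff_square: "(norm (x - y))\<^sup>2 = (norm x)\<^sup>2 - 2 * Re (cinner x y) + (norm y)\<^sup>2"
  for x :: "'a::complex_hilbert"
  using norm_add_square[of x "- y"] by (simp add: cinner_minus_right)

lemma cauchy_schwarz: "cmod (cinner x y) \<le> norm x * norm y" for x :: "'a::complex_hilbert"
proof (cases "x = 0")
  case False
  then have nx: "norm x > 0" by simp
  define c where "c = cinner x y"
  \<comment> \<open>The orthogonal projection of \<open>y\<close> onto the line through \<open>x\<close>.\<close>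
  define u where "u = (c / of_real ((norm x)\<^sup>2)) *\<^sub>C x"
  have "cinner y u = c * cnj c / of_real ((norm x)\<^sup>2)"
    unfolding u_def c_def by (simp add: cinner_scaleC_right cinner_commute[of y x])
  then have yu: "Re (cinner y u) = (cmod c)\<^sup>2 / (norm x)\<^sup>2"
    by (simp add: complex_norm_square[symmetric] flip: of_real_power of_real_divide)
  have nu: "(norm u)\<^sup>2 = (cmod c)\<^sup>2 / (norm x)\<^sup>2"
    unfolding u_def norm_scaleC norm_divide norm_of_real using nx
    by (simp add: power2_eq_square)
  have "0 \<le> (norm (y - u))\<^sup>2" by simp
  then have "(cmod c)\<^sup>2 / (norm x)\<^sup>2 \<le> (norm y)\<^sup>2"
    unfolding norm_diff_square yu nu by linarith
  then have "(cmod c)\<^sup>2 \<le> (norm x * norm y)\<^sup>2"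
    using nx by (simp add: pos_divide_le_eq power_mult_distrib mult.commute)
  then show ?thesis unfolding c_def by (rule power2_le_imp_le) simp
qed simp

lemma bounded_bilinear_cinner: "bounded_bilinear (cinner :: 'a::complex_hilbert \<Rightarrow> _)"
proof
  show "\<exists>K. \<forall>a b::'a. norm (cinner a b) \<le> norm a * norm b * K"
    by (intro exI[of _ 1]) (simp add: cauchy_schwarz)
qed (simp_all add: cinner_add_left cinner_add_right cinner_scaleR_left cinner_scaleR_right scaleR_conv_of_real)

lemma continuous_on_cinner [continuous_intros]:
  "continuous_on S f \<Longrightarrow> continuous_on S g \<Longrightarrow>
    continuous_on S (\<lambda>x. cinner (f x) (g x :: 'a::complex_hilbert))"
  by (rule bounded_bilinear.continuous_on[OF bounded_bilinear_cinner])

lemma continuous_on_scaleC [continuous_intros]: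
  "continuous_on S f \<Longrightarrow> continuous_on S (\<lambda>x. c *\<^sub>C (f x :: 'a::complex_normed_vector))"
  by (rule bounded_linear.continuous_on[OF bounded_linear_scaleC])

lemma cinner_eq_right: "(\<And>z. cinner z x = cinner z y) \<Longrightarrow> x = y" for x :: "'a::complex_hilbert"
proof -
  assume "\<And>z. cinner z x = cinner z y"
  then have "cinner (x - y) (x - y) = 0" by (simp add: cinner_diff_right)
  then show ?thesis by (simp add: cinner_self)
qed

text \<open>The vectors orthogonal to \<open>x - y\<close> form a closed subspace.\<close>

lemma cinner_eq_on_total:
  assumes "closed_cspan S = UNIV" and "\<And>s. s \<in> S \<Longrightarrow> cinner s x = cinner s y"
  shows "x = (y::'a::complex_hilbert)"
proof -
  define C where "C = {z. cinner z (x - y) = 0}"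
  have "closed_cspan S \<subseteq> C"
  proof (rule closed_cspan_minimal)
    show "S \<subseteq> C" using assms(2) by (auto simp: C_def cinner_diff_right)
    show "csubspace C"
      by (rule csubspaceI) (auto simp: C_def cinner_add_left cinner_scaleC_left)
    show "closed C" unfolding C_def
      by (intro closed_Collect_eq continuous_intros)
  qed
  then have "cinner (x - y) (x - y) = 0" using assms(1) by (auto simp: C_def)
  then show ?thesis by (simp add: cinner_self)
qed

section \<open>Adjoints\<close>

text \<open>The representing vector minimises \<open>J h = \<parallel>h\<parallel>\<^sup>2 - 2 f h\<close>.  By the parallelogram law a minimising
  sequence is Cauchy, and the first variation of \<open>J\<close> vanishes at its limit.\<close>

lemma riesz_representation:
  fixes f :: "'a::complex_hilbert \<Rightarrow> real"
  assumes f: "bounded_linear f"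
  shows "\<exists>g. \<forall>h. Re (cinner g h) = f h"
proof -
  interpret f: bounded_linear f by (rule f)
  define J where "J h = (norm h)\<^sup>2 - 2 * f h" for h
  obtain K where K: "\<And>h. norm (f h) \<le> norm h * K" using f.bounded by blast
  have "J h \<ge> - K\<^sup>2" for h
  proof -
    have "f h \<le> norm h * K" using K[of h] by simp
    moreover have "0 \<le> (norm h - K)\<^sup>2" by simp
    ultimately show ?thesis unfolding J_def power2_diff by linarith
  qed
  then have bdd: "bdd_below (range J)" by (intro bdd_belowI[of _ "- K\<^sup>2"]) auto
  define m where "m = Inf (range J)"
  have m: "m \<le> J h" for h unfolding m_def using bdd by (intro cInf_lower) auto
  have "\<exists>h. J h < m + 1 / real (Suc n)" for n
    using cInf_lessD[of "range J" "m + 1 / real (Suc n)"] unfolding m_def by auto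
  then obtain h where h: "\<And>n. J (h n) < m + 1 / real (Suc n)" by metis
  have gap: "(norm (h i - h j))\<^sup>2 \<le> 2 / real (Suc i) + 2 / real (Suc j)" for i j
  proof -
    have mid: "J ((1/2) *\<^sub>R (h i + h j)) = (J (h i) + J (h j)) / 2 - (norm (h i - h j))\<^sup>2 / 4"
      unfolding J_def f.scaleR f.add norm_scaleR power_mult_distrib norm_add_square norm_diff_square
      by (simp add: field_simps)
    show ?thesis
      using m[of "(1/2) *\<^sub>R (h i + h j)"] h[of i] h[of j] unfolding mid by argo
  qed
  have "Cauchy h"
  proof (rule CauchyI)
    fix e :: real assume "0 < e"
    then obtain N where N: "4 / e\<^sup>2 < real (Suc N)"
      using reals_Archimedean2[of "4 / e\<^sup>2"] by (metis less_SucI of_nat_less_iff order_less_trans lessI)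
    have "norm (h i - h j) < e" if "i \<ge> N" "j \<ge> N" for i j
    proof -
      have "2 / real (Suc i) + 2 / real (Suc j) \<le> 2 / real (Suc N) + 2 / real (Suc N)"
        using that by (intro add_mono divide_left_mono) auto
      also have "\<dots> < e\<^sup>2"
      proof -
        have "4 / real (Suc N) < e\<^sup>2" using N \<open>0 < e\<close> by (simp add: field_simps)
        then show ?thesis by simp
      qed
      finally have "(norm (h i - h j))\<^sup>2 < e\<^sup>2" using gap[of i j] by linarith
      then show ?thesis using \<open>0 < e\<close> power_less_imp_less_base by fastforce
    qed
    then show "\<exists>M. \<forall>m\<ge>M. \<forall>n\<ge>M. norm (h m - h n) < e" by blast
  qed
  then obtain g where g: "h \<longlonglongrightarrow> g" using Cauchy_convergent convergentD by metis
  have "(\<lambda>n. J (h n)) \<longlonglongrightarrow> J g"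
    unfolding J_def by (intro tendsto_intros g f.tendsto)
  moreover have "(\<lambda>n. m + 1 / real (Suc n)) \<longlonglongrightarrow> m"
    using tendsto_add[OF tendsto_const[of m] LIMSEQ_inverse_real_of_nat]
    by (simp add: inverse_eq_divide)
  ultimately have "J g \<le> m" using h by (intro LIMSEQ_le) (auto intro: less_imp_le)
  have "Re (cinner g k) = f k" for k
  proof -
    define d where "d = Re (cinner g k) - f k"
    have quad: "0 \<le> t\<^sup>2 * (norm k)\<^sup>2 + 2 * t * d" for t
    proof -
      have "J (g + t *\<^sub>R k) = J g + (t\<^sup>2 * (norm k)\<^sup>2 + 2 * t * d)"
        unfolding J_def norm_add_square d_def f.add f.scaleR cinner_scaleR_right
        by (simp add: power_mult_distrib algebra_simps)
      then show ?thesis using m[of "g + t *\<^sub>R k"] \<open>J g \<le> m\<close> by linarith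
    qed
    \<comment> \<open>The choice \<open>t = - d / N\<close> makes the linear term dominate; adding 1 covers \<open>k = 0\<close>.\<close>
    define N where "N = (norm k)\<^sup>2 + 1"
    have "N > 0" by (simp add: N_def add_nonneg_pos)
    have "t\<^sup>2 * (norm k)\<^sup>2 \<le> t\<^sup>2 * N" for t unfolding N_def by (intro mult_left_mono) auto
    then have "0 \<le> (- (d / N))\<^sup>2 * N + 2 * (- (d / N)) * d"
      using quad[of "- (d / N)"] by (meson add_right_mono order_trans)
    also have "\<dots> = - (d\<^sup>2 / N)" using \<open>N > 0\<close> by (simp add: field_simps power2_eq_square)
    finally have "d\<^sup>2 / N \<le> 0" by simp
    then have "d = 0" using \<open>N > 0\<close> by (simp add: divide_le_0_iff)
    then show ?thesis by (simp add: d_def)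
  qed
  then show ?thesis by blast
qed

lemma bounded_ops_scaleC: "T \<in> bounded_ops \<Longrightarrow> blinfun_apply T (c *\<^sub>C x) = c *\<^sub>C T x"
  unfolding bounded_ops_def Vector_Spaces.linear_def by (auto dest: module_hom.scale)

lemma bounded_opsI: "(\<And>c x. blinfun_apply T (c *\<^sub>C x) = c *\<^sub>C T x) \<Longrightarrow> T \<in> bounded_ops"
  unfolding bounded_ops_def Vector_Spaces.linear_def
  by (auto intro!: vector_space_scaleC module_hom.intro module_scaleC module_hom_axioms.intro simp: blinfun.add_right)

lemma adjoint_exists:
  assumes T: "T \<in> bounded_ops"
  shows "\<exists>S. \<forall>h k. cinner (blinfun_apply T h) k = cinner h (blinfun_apply S k)"
proof -
  have "\<exists>g. \<forall>h. cinner (blinfun_apply T h) k = cinner h g" for k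
  proof -
    have "bounded_linear (\<lambda>h. Re (cinner k (T h)))"
      by (intro bounded_linear_compose[OF bounded_linear_Re]
          bounded_linear_compose[OF bounded_bilinear.bounded_linear_right[OF bounded_bilinear_cinner]]
          blinfun.bounded_linear_right)
    then obtain g where g: "\<And>h. Re (cinner g h) = Re (cinner k (T h))"
      using riesz_representation by metis
    have "cinner g h = cinner k (T h)" for h
      \<comment> \<open>Up to sign, real parts at \<open>i h\<close> are imaginary parts at \<open>h\<close>.\<close>
      using g[of h] g[of "\<i> *\<^sub>C h"]
      by (simp add: bounded_ops_scaleC[OF T] cinner_scaleC_right complex_eq_iff)
    then have "cinner (T h) k = cinner h g" for h
      by (metis cinner_commute)
    then show ?thesis by blast
  qed
  then obtain S where S: "\<And>h k. cinner (T h) k = cinner h (S k)" by metis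
  have "bounded_linear S"
  proof
    fix x y r
    show "S (x + y) = S x + S y"
      by (rule cinner_eq_right) (simp add: S[symmetric] cinner_add_right)
    show "S (r *\<^sub>R x) = r *\<^sub>R S x"
      by (rule cinner_eq_right) (simp add: S[symmetric] cinner_scaleR_right)
    have "norm (S x) \<le> norm x * norm T" for x
    proof (cases "S x = 0")
      case False
      have "complex_of_real ((norm (S x))\<^sup>2) = cinner (T (S x)) x"
        unfolding S by (simp add: cinner_self)
      then have "(norm (S x))\<^sup>2 = cmod (cinner (T (S x)) x)"
        by (metis norm_of_real abs_of_nonneg zero_le_power2)
      also have "\<dots> \<le> norm (T (S x)) * norm x" by (rule cauchy_schwarz)
      also have "\<dots> \<le> norm T * norm (S x) * norm x"
        by (intro mult_right_mono norm_blinfun) auto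
      finally show ?thesis using False by (simp add: power2_eq_square mult.assoc mult.left_commute mult.commute)
    qed simp
    then show "\<exists>K. \<forall>x. norm (S x) \<le> norm x * K" by blast
  qed
  then have "blinfun_apply (Blinfun S) = S" by (rule bounded_linear_Blinfun_apply)
  then show ?thesis using S by metis
qed

lemma adj_eqI:
  assumes "\<And>h k. cinner (blinfun_apply T h) k = cinner h (blinfun_apply S k)"
  shows "adj T = S"
  unfolding adj_def
proof (rule the_equality)
  fix S' assume S': "\<forall>h k. cinner (blinfun_apply T h) k = cinner h (blinfun_apply S' k)"
  show "S' = S"
  proof (rule blinfun_eqI)
    show "S' k = S k" for k by (rule cinner_eq_right) (metis S' assms)
  qed
qed (use assms in blast)

lemma cinner_adj_right:
  assumes "T \<in> bounded_ops"
  shows "cinner h (blinfun_apply (adj T) k) = cinner (blinfun_apply T h) k"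
proof -
  obtain S where S: "\<And>h k. cinner (blinfun_apply T h) k = cinner h (blinfun_apply S k)"
    using adjoint_exists[OF assms] by blast
  show ?thesis unfolding adj_eqI[OF S] by (rule S[symmetric])
qed

lemma cinner_adj_left:
  assumes "T \<in> bounded_ops"
  shows "cinner (blinfun_apply (adj T) k) h = cinner k (blinfun_apply T h)"
  by (metis cinner_adj_right[OF assms] cinner_commute)

lemma adj_in_bounded_ops:
  assumes "T \<in> bounded_ops"
  shows "adj T \<in> bounded_ops"
proof (rule bounded_opsI)
  show "adj T (c *\<^sub>C x) = c *\<^sub>C adj T x" for c x
    by (rule cinner_eq_right) (simp add: cinner_adj_right[OF assms] cinner_scaleC_right)
qed

lemma compose_in_bounded_ops: "S \<in> bounded_ops \<Longrightarrow> T \<in> bounded_ops \<Longrightarrow> S o\<^sub>L T \<in> bounded_ops"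
  by (rule bounded_opsI) (simp add: bounded_ops_scaleC)

lemma bounded_ops_eq_on_total:
  assumes "closed_cspan M = UNIV" "S \<in> bounded_ops" "T \<in> bounded_ops"
    and "\<And>x. x \<in> M \<Longrightarrow> blinfun_apply S x = blinfun_apply T x"
  shows "S = T"
proof (rule blinfun_eqI)
  fix y
  have "closed_cspan M \<subseteq> {x. S x = T x}"
  proof (rule closed_cspan_minimal)
    show "M \<subseteq> {x. S x = T x}" using assms(4) by auto
    show "csubspace {x. S x = T x}"
      by (rule csubspaceI) (auto simp: blinfun.add_right bounded_ops_scaleC assms)
    show "closed {x. S x = T x}" by (intro closed_Collect_eq continuous_intros)
  qed
  then show "S y = T y" using assms(1) by auto
qed


section \<open>Representations of C*-algebras are contractive\<close>

lemma star_zero [simp]: "star 0 = (0::'a::cstar_algebra)"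
  using star_add[of 0 "0::'a"] by simp

lemma star_minus: "star (- a) = - star (a::'a::cstar_algebra)"
  using minus_unique[of "star a" "star (- a)"] star_add[of a "- a"] by simp

lemma star_diff: "star (a - b) = star a - star (b::'a::cstar_algebra)"
  using star_add[of a "- b"] by (simp add: star_minus)

lemma star_scaleR: "star (r *\<^sub>R a) = r *\<^sub>R star (a::'a::cstar_algebra)"
  unfolding scaleR_eq_scaleC by (simp add: star_scaleC)

lemma norm_star [simp]: "norm (star a) = norm (a::'a::cstar_algebra)"
proof -
  have le: "norm b \<le> norm (star b)" for b :: 'a
  proof (cases "b = 0")
    case False
    have "norm b * norm b = norm (star b * b)"
      by (simp add: norm_star_mult_self power2_eq_square)
    also have "\<dots> \<le> norm (star b) * norm b" by (rule norm_mult_ineq)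
    finally show ?thesis using False by simp
  qed simp
  from le[of a] le[of "star a"] show ?thesis by (simp add: star_star)
qed

lemma bounded_linear_star: "bounded_linear (star :: 'a::cstar_algebra \<Rightarrow> 'a)"
  by (rule bounded_linear_intro[of _ 1]) (simp_all add: star_add star_scaleR)

lemma clinear_add: "clinear f \<Longrightarrow> f (x + y) = f x + f y"
  and clinear_scaleC: "clinear f \<Longrightarrow> f (c *\<^sub>C x) = c *\<^sub>C f x"
  unfolding Vector_Spaces.linear_def by (auto dest: module_hom.add module_hom.scale)

lemma clinear_diff: "clinear f \<Longrightarrow> f (x - y) = f x - f y"
  using clinear_add[of f x "(-1) *\<^sub>C y"] clinear_scaleC[of f "-1" y] by simp

lemma clinear_scaleR: "clinear f \<Longrightarrow> f (r *\<^sub>R x) = r *\<^sub>R f x"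
  unfolding scaleR_eq_scaleC by (rule clinear_scaleC)

text \<open>If \<open>R\<close> is self-adjoint and \<open>T\<^sup>* T = 2 R - R\<^sup>2\<close>, then \<open>1 - T\<^sup>* T = (1 - R)\<^sup>2\<close> is positive, so \<open>T\<close> is a
  contraction.  Only the values at one vector \<open>h\<close>, with \<open>u = T h\<close>, enter.\<close>

lemma norm_le_of_square_root:
  fixes R :: "'h::complex_hilbert \<Rightarrow> 'h"
  assumes "cinner (R h) h = cinner h (R h)" "cinner (R h) (R h) = cinner h (R (R h))"
    and "cinner u u = cinner h (2 *\<^sub>R R h - R (R h))"
  shows "norm u \<le> norm h"
proof -
  have "cinner u u = 2 * cinner h (R h) - cinner (R h) (R h)"
    using assms by (simp add: cinner_diff_right cinner_scaleR_right)
  from arg_cong[OF this, of Re]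
  have "(norm u)\<^sup>2 + (norm (h - R h))\<^sup>2 = (norm h)\<^sup>2"
    unfolding norm_diff_square by (simp add: cinner_self flip: of_real_power)
  then show ?thesis
    by (metis le_add_same_cancel1 norm_ge_zero power2_le_imp_le zero_le_power2)
qed

locale star_rep =
  fixes \<pi> :: "'a::cstar_algebra \<Rightarrow> 'h::complex_hilbert \<Rightarrow>\<^sub>L 'h"
  assumes rep: "star_representation \<pi>"
begin

lemma ops: "\<pi> a \<in> bounded_ops"
  using rep by (auto simp: star_representation_def)

lemma lin: "clinear \<pi>"
  using rep by (simp add: star_representation_def)

lemma mult: "\<pi> (a * b) = \<pi> a o\<^sub>L \<pi> b"
  using rep by (simp add: star_representation_def)

lemma star: "\<pi> (star a) = adj (\<pi> a)"
  using rep by (simp add: star_representation_def)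

lemma cinner_rep_left: "cinner (\<pi> a h) k = cinner h (\<pi> (star a) k)"
  by (simp add: star cinner_adj_right[OF ops])

lemma cinner_rep_right: "cinner h (\<pi> a k) = cinner (\<pi> (star a) h) k"
  by (simp add: star cinner_adj_left[OF ops])

text \<open>The equation for \<open>s\<close> is solved in the algebra and transported by \<open>\<pi>\<close>, which preserves it as
  a homomorphism; continuity of \<open>\<pi>\<close> is a consequence.\<close>

lemma norm_rep_le_one:
  assumes "norm a < 1"
  shows "norm (\<pi> a h) \<le> norm h"
proof -
  let ?d = "star a * a"
  have "(norm a)\<^sup>2 < 1" using assms by (simp add: abs_square_less_1)
  then have d: "norm ?d < 1" by (simp add: norm_star_mult_self)
  define C where "C = {s::'a. star s = s}"
  have "\<exists>s\<in>C. 2 *\<^sub>R s - s * s = ?d"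
  proof (rule quadratic_equation_solution[OF bounded_bilinear_mult norm_mult_ineq _ _ _ d])
    show "closed C" unfolding C_def
      by (intro closed_Collect_eq continuous_intros bounded_linear.continuous_on[OF bounded_linear_star])
  qed (auto simp: C_def star_scaleR star_add star_mult star_star)
  then obtain s where s: "star s = s" "2 *\<^sub>R s - s * s = ?d" by (auto simp: C_def)
  show ?thesis
  proof (rule norm_le_of_square_root)
    show "cinner (\<pi> s h) h = cinner h (\<pi> s h)" by (simp add: cinner_rep_left s)
    show "cinner (\<pi> s h) (\<pi> s h) = cinner h (\<pi> s (\<pi> s h))" by (simp add: cinner_rep_left s)
    have "cinner (\<pi> a h) (\<pi> a h) = cinner h (\<pi> ?d h)"
      by (simp add: cinner_rep_left mult)
    also have "\<pi> ?d h = 2 *\<^sub>R \<pi> s h - \<pi> s (\<pi> s h)"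
      unfolding s(2)[symmetric] clinear_diff[OF lin] clinear_scaleR[OF lin] mult
      by (simp add: blinfun.diff_left blinfun.scaleR_left)
    finally show "cinner (\<pi> a h) (\<pi> a h) = cinner h (2 *\<^sub>R \<pi> s h - \<pi> s (\<pi> s h))" .
  qed
qed

lemma norm_rep_le: "norm (\<pi> a h) \<le> norm a * norm h"
proof -
  have "1 * norm (\<pi> a h) \<le> norm h * norm a"
  proof (rule bound_by_scaling)
    fix r :: real assume "r > 0" "r * norm a < 1"
    then show "r * norm (\<pi> a h) \<le> norm h"
      using norm_rep_le_one[of "r *\<^sub>R a" h]
      by (simp add: clinear_scaleR[OF lin] blinfun.scaleR_left)
  qed auto
  then show ?thesis by (simp add: mult.commute)
qed

end

section \<open>Hilbert modules\<close>

context hilbert_module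
begin

lemma ip_add_left: "ip (x + y) z = ip x z + ip y z"
  using ip_commute[of "x + y" z] ip_commute[of x z] ip_commute[of y z]
  by (simp add: ip_add_right star_add)

lemma ip_scaleC_left: "ip (c *\<^sub>C x) y = cnj c *\<^sub>C ip x y"
  using ip_commute[of "c *\<^sub>C x" y] ip_commute[of x y] by (simp add: ip_scaleC_right star_scaleC)

lemma ip_act_left: "ip (act x a) y = star a * ip x y"
  using ip_commute[of "act x a" y] ip_commute[of x y] by (simp add: ip_act_right star_mult)

lemma ip_scaleR_right: "ip x (r *\<^sub>R y) = r *\<^sub>R ip x y"
  unfolding scaleR_eq_scaleC by (rule ip_scaleC_right)

lemma ip_scaleR_left: "ip (r *\<^sub>R x) y = r *\<^sub>R ip x y"
  unfolding scaleR_eq_scaleC by (simp add: ip_scaleC_left)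

lemma ip_zero_right [simp]: "ip x 0 = 0"
  using ip_add_right[of x 0 0] by simp

lemma ip_zero_left [simp]: "ip 0 x = 0"
  using ip_add_left[of 0 0 x] by simp

lemma ip_diff_right: "ip x (y - z) = ip x y - ip x z"
  using ip_add_right[of x "y - z" z] by simp

lemma ip_diff_left: "ip (x - y) z = ip x z - ip y z"
  using ip_add_left[of "x - y" y z] by simp

lemma ip_eq_right: "(\<And>z. ip z x = ip z y) \<Longrightarrow> x = y"
  using ip_self_eq_0[of "x - y"] by (simp add: ip_diff_right)

lemma norm_ip_self: "norm (ip x x) = (norm x)\<^sup>2"
  by (simp add: norm_eq_sqrt_ip)

lemma norm_act_le: "norm (act x a) \<le> norm x * norm a"
proof (rule power2_le_imp_le)
  have "(norm (act x a))\<^sup>2 = norm (star a * ip x x * a)"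
    by (simp add: norm_ip_self[symmetric] ip_act_left ip_act_right mult.assoc)
  also have "\<dots> \<le> norm (star a) * norm (ip x x) * norm a"
    by (intro order_trans[OF norm_mult_ineq] mult_right_mono norm_mult_ineq) simp
  finally show "(norm (act x a))\<^sup>2 \<le> (norm x * norm a)\<^sup>2"
    by (simp add: norm_ip_self power2_eq_square mult_ac)
qed simp

text \<open>Polarization expresses \<open>4 \<langle>u, v\<rangle>\<close> by the four values \<open>\<langle>u + c v, u + c v\<rangle>\<close> with \<open>c\<^sup>4 = 1\<close>, each of norm
  at most \<open>(\<parallel>u\<parallel> + \<parallel>v\<parallel>)\<^sup>2\<close>.  This gives up the sharp constant in exchange for a proof that does not touch
  the order structure of the algebra.\<close>

lemma norm_ip_le: "norm (ip x y) \<le> 4 * norm x * norm y"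
proof (cases "x = 0 \<or> y = 0")
  case False
  have pol: "norm (ip u v) \<le> (norm u + norm v)\<^sup>2" for u v
  proof -
    define q where "q c = ip (u + c *\<^sub>C v) (u + c *\<^sub>C v)" for c
    have q: "norm (q c) \<le> (norm u + norm v)\<^sup>2" if "cmod c = 1" for c
      using power_mono[OF norm_triangle_ineq[of u "c *\<^sub>C v"], of 2] that
      by (simp add: q_def norm_ip_self norm_scaleC)
    have exp: "q c = ip u u + c *\<^sub>C ip u v + cnj c *\<^sub>C ip v u + (cnj c * c) *\<^sub>C ip v v" for c
      by (simp add: q_def ip_add_left ip_add_right ip_scaleC_left ip_scaleC_right scaleC_scaleC
          scaleC_add_right mult.commute)
    have neg: "(- c) *\<^sub>C w = - (c *\<^sub>C w)" for c and w :: 'a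
      using scaleC_scaleC[of "-1" c w] by simp
    have "q 1 - q (-1) = 2 *\<^sub>R ip u v + 2 *\<^sub>R ip v u"
      unfolding exp by (simp add: scaleC_one scaleR_2)
    moreover have "\<i> *\<^sub>C (q \<i> - q (- \<i>)) = 2 *\<^sub>R ip v u - 2 *\<^sub>R ip u v"
      unfolding exp
      by (simp add: scaleC_one scaleR_2 neg scaleC_add_right scaleC_diff_right scaleC_scaleC scaleC_minus_right)
    ultimately have eq: "4 *\<^sub>R ip u v = (q 1 - q (-1)) - \<i> *\<^sub>C (q \<i> - q (- \<i>))"
      using scaleR_add_left[of 2 2 "ip u v"] by (simp add: scaleR_2)
    have "norm (4 *\<^sub>R ip u v) \<le> (norm (q 1) + norm (q (-1))) + (norm (q \<i>) + norm (q (- \<i>)))"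
      unfolding eq
      by (intro order_trans[OF norm_triangle_ineq4] add_mono norm_triangle_ineq4)
         (simp add: norm_scaleC norm_triangle_ineq4)
    then show ?thesis
      using q[of 1] q[of "-1"] q[of "\<i>"] q[of "-\<i>"] by simp
  qed
  have "norm (ip ((1 / norm x) *\<^sub>R x) ((1 / norm y) *\<^sub>R y)) \<le> 4"
    using pol[of "(1 / norm x) *\<^sub>R x" "(1 / norm y) *\<^sub>R y"] False by simp
  then show ?thesis
    using False by (simp add: ip_scaleR_left ip_scaleR_right field_simps)
qed auto

lemma bounded_bilinear_ip: "bounded_bilinear ip"
proof
  show "\<exists>K. \<forall>a b. norm (ip a b) \<le> norm a * norm b * K"
    by (intro exI[of _ 4]) (use norm_ip_le in \<open>simp add: mult_ac\<close>)
qed (simp_all add: ip_add_left ip_add_right ip_scaleR_left ip_scaleR_right)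

lemma continuous_on_ip [continuous_intros]:
  "continuous_on S f \<Longrightarrow> continuous_on S g \<Longrightarrow> continuous_on S (\<lambda>x. ip (f x) (g x))"
  by (rule bounded_bilinear.continuous_on[OF bounded_bilinear_ip])

lemma bounded_linear_rank_one: "bounded_linear (\<lambda>z. act x (ip y z))"
proof (rule bounded_linear_intro)
  fix z
  have "norm (act x (ip y z)) \<le> norm x * (4 * norm y * norm z)"
    by (rule order_trans[OF norm_act_le mult_left_mono[OF norm_ip_le]]) simp
  then show "norm (act x (ip y z)) \<le> norm z * (4 * norm x * norm y)"
    by (simp add: mult_ac)
qed (simp_all add: ip_add_right act_add_right scaleR_eq_scaleC ip_scaleC_right act_scaleC_right)

lemma rank_one_apply: "blinfun_apply (rank_one_op act ip x y) z = act x (ip y z)"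
  unfolding rank_one_op_def by (simp add: bounded_linear_Blinfun_apply bounded_linear_rank_one)

definition is_adjoint :: "('x \<Rightarrow>\<^sub>L 'x) \<Rightarrow> ('x \<Rightarrow>\<^sub>L 'x) \<Rightarrow> bool" where
  "is_adjoint T S \<longleftrightarrow> (\<forall>x y. ip (blinfun_apply T x) y = ip x (blinfun_apply S y))"

lemma is_adjoint_left: "is_adjoint T S \<Longrightarrow> ip (blinfun_apply T x) y = ip x (blinfun_apply S y)"
  by (simp add: is_adjoint_def)

lemma is_adjoint_sym:
  assumes "is_adjoint T S" shows "is_adjoint S T"
  unfolding is_adjoint_def
proof (intro allI)
  fix x y
  show "ip (S x) y = ip x (T y)"
    using is_adjoint_left[OF assms, of y x] ip_commute[of "S x" y] ip_commute[of x "T y"] by simp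
qed

lemma is_adjoint_compose:
  "is_adjoint T S \<Longrightarrow> is_adjoint T' S' \<Longrightarrow> is_adjoint (T o\<^sub>L T') (S' o\<^sub>L S)"
  by (simp add: is_adjoint_def)

lemma is_adjoint_add:
  "is_adjoint T S \<Longrightarrow> is_adjoint T' S' \<Longrightarrow> is_adjoint (T + T') (S + S')"
  by (simp add: is_adjoint_def blinfun.add_left ip_add_left ip_add_right)

lemma is_adjoint_diff:
  "is_adjoint T S \<Longrightarrow> is_adjoint T' S' \<Longrightarrow> is_adjoint (T - T') (S - S')"
  by (simp add: is_adjoint_def blinfun.diff_left ip_diff_left ip_diff_right)

lemma is_adjoint_scaleC: "is_adjoint T S \<Longrightarrow> is_adjoint (c *\<^sub>C T) (cnj c *\<^sub>C S)"
  by (simp add: is_adjoint_def scaleC_blinfun.rep_eq ip_scaleC_left ip_scaleC_right)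

lemma is_adjoint_scaleR: "is_adjoint T S \<Longrightarrow> is_adjoint (r *\<^sub>R T) (r *\<^sub>R S)"
  by (simp add: is_adjoint_def blinfun.scaleR_left ip_scaleR_left ip_scaleR_right)

lemma adjointable_scaleC:
  assumes "is_adjoint T S" shows "blinfun_apply T (c *\<^sub>C x) = c *\<^sub>C T x"
  by (rule ip_eq_right)
     (simp add: is_adjoint_left[OF is_adjoint_sym[OF assms], symmetric] ip_scaleC_right)

lemma adjointable_act:
  assumes "is_adjoint T S" shows "blinfun_apply T (act x a) = act (T x) a"
  by (rule ip_eq_right)
     (simp add: is_adjoint_left[OF is_adjoint_sym[OF assms], symmetric] ip_act_right)

lemma norm_adjoint_le:
  assumes "is_adjoint T S" shows "norm S \<le> 4 * norm T"
proof (rule norm_blinfun_bound)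
  fix y
  show "norm (S y) \<le> 4 * norm T * norm y"
  proof (cases "S y = 0")
    case False
    have "(norm (S y))\<^sup>2 = norm (ip (T (S y)) y)"
      by (simp add: norm_ip_self[symmetric] is_adjoint_left[OF assms])
    also have "\<dots> \<le> 4 * norm (T (S y)) * norm y" by (rule norm_ip_le)
    also have "\<dots> \<le> 4 * (norm T * norm (S y)) * norm y"
      by (intro mult_right_mono mult_left_mono norm_blinfun) auto
    finally show ?thesis using False by (simp add: power2_eq_square mult_ac)
  qed simp
qed simp

lemma rank_one_adjoint: "is_adjoint (rank_one_op act ip x y) (rank_one_op act ip y x)"
  by (simp add: is_adjoint_def rank_one_apply ip_act_left ip_act_right ip_commute[of _ y, symmetric])

lemma compose_rank_one:
  assumes "is_adjoint T S"
  shows "T o\<^sub>L rank_one_op act ip x y = rank_one_op act ip (T x) y"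
  by (rule blinfun_eqI) (simp add: rank_one_apply adjointable_act[OF assms])

lemma csubspace_compact_ops: "csubspace (compact_ops act ip)"
  unfolding compact_ops_def by (rule csubspace_closed_cspan)

lemma closed_compact_ops: "closed (compact_ops act ip)"
  unfolding compact_ops_def by (rule closed_closed_cspan)

lemma rank_one_compact: "rank_one_op act ip x y \<in> compact_ops act ip"
  unfolding compact_ops_def by (rule subsetD[OF closed_cspan_superset]) auto

lemma compact_ops_minimal:
  assumes "\<And>x y. rank_one_op act ip x y \<in> C" "csubspace C" "closed C"
  shows "compact_ops act ip \<subseteq> C"
  unfolding compact_ops_def using assms by (intro closed_cspan_minimal) auto

text \<open>The pairs of compact operators that are adjoint to each other form a closed graph, bounded by
  \<open>norm_adjoint_le\<close>, whose domain contains the rank one operators.\<close>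

lemma compact_adjoint_exists:
  assumes "T \<in> compact_ops act ip"
  obtains S where "S \<in> compact_ops act ip" "is_adjoint T S"
proof -
  let ?K = "compact_ops act ip"
  note K = csubspace_compact_ops
  define P where "P = (?K \<times> ?K) \<inter> {p. \<forall>x y. ip (blinfun_apply (fst p) x) y = ip x (blinfun_apply (snd p) y)}"
  have P: "(T, S) \<in> P \<longleftrightarrow> T \<in> ?K \<and> S \<in> ?K \<and> is_adjoint T S" for T S
    by (auto simp: P_def is_adjoint_def)
  have "?K \<subseteq> fst ` P"
  proof (rule compact_ops_minimal)
    show "rank_one_op act ip x y \<in> fst ` P" for x y
      using P rank_one_compact rank_one_adjoint by (metis fst_conv image_eqI)
    show "csubspace (fst ` P)"
    proof (rule csubspaceI)
      have "(0, 0) \<in> P" unfolding P by (simp add: csubspace_0[OF K] is_adjoint_def)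
      then show "0 \<in> fst ` P" by force
      fix T T' assume "T \<in> fst ` P" "T' \<in> fst ` P"
      then obtain S S' where S: "(T, S) \<in> P" "(T', S') \<in> P" by auto
      then have "(T + T', S + S') \<in> P"
        unfolding P by (simp add: csubspace_add[OF K] is_adjoint_add)
      then show "T + T' \<in> fst ` P" by force
      fix c
      have "(c *\<^sub>C T, cnj c *\<^sub>C S) \<in> P"
        using S(1) unfolding P by (simp add: csubspace_scaleC[OF K] is_adjoint_scaleC)
      then show "c *\<^sub>C T \<in> fst ` P" by force
    qed
    show "closed (fst ` P)"
    proof (rule closed_domain_of_bounded_graph)
      show "closed P" unfolding P_def
        by (intro closed_Int closed_Times closed_compact_ops closed_Collect_all closed_Collect_eq
            continuous_intros)
      show "p - q \<in> P" if "p \<in> P" "q \<in> P" for p q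
        using that P by (cases p; cases q) (simp add: csubspace_diff[OF K] is_adjoint_diff)
      show "norm S \<le> 4 * norm T" if "(T, S) \<in> P" for T S
        using that unfolding P by (simp add: norm_adjoint_le)
    qed
  qed
  then obtain S where "(T, S) \<in> P" using assms by auto
  then show thesis using that unfolding P by blast
qed

lemma compact_compose:
  assumes "is_adjoint S S'" "T \<in> compact_ops act ip"
  shows "S o\<^sub>L T \<in> compact_ops act ip"
proof -
  let ?C = "{T. S o\<^sub>L T \<in> compact_ops act ip}"
  have "compact_ops act ip \<subseteq> ?C"
  proof (rule compact_ops_minimal)
    show "rank_one_op act ip x y \<in> ?C" for x y
      by (simp add: compose_rank_one[OF assms(1)] rank_one_compact)
    have comp: "S o\<^sub>L (c *\<^sub>C T) = c *\<^sub>C (S o\<^sub>L T)" for c T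
      by (rule blinfun_eqI) (simp add: scaleC_blinfun.rep_eq adjointable_scaleC[OF assms(1)])
    have add: "S o\<^sub>L (T + T') = (S o\<^sub>L T) + (S o\<^sub>L T')" for T T'
      by (rule bounded_bilinear.add_right[OF bounded_bilinear_blinfun_compose])
    show "csubspace ?C"
      by (rule csubspaceI)
         (auto simp: comp add csubspace_add[OF csubspace_compact_ops]
           csubspace_scaleC[OF csubspace_compact_ops] csubspace_0[OF csubspace_compact_ops])
    have "closed ((\<lambda>T. S o\<^sub>L T) -` compact_ops act ip)"
      by (intro closed_vimage closed_compact_ops continuous_intros
          bounded_bilinear.continuous_on[OF bounded_bilinear_blinfun_compose])
    then show "closed ?C" by (simp add: vimage_def)
  qed
  then show ?thesis using assms(2) by auto
qed

lemma closed_selfadjoint: "closed {t. is_adjoint t t}"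
  unfolding is_adjoint_def
  by (intro closed_Collect_all closed_Collect_eq continuous_intros)

lemma bounded_bilinear_compose: "bounded_bilinear ((o\<^sub>L) :: ('x \<Rightarrow>\<^sub>L 'x) \<Rightarrow> _)"
  by (rule bounded_bilinear_blinfun_compose)

text \<open>For \<open>\<parallel>S\<parallel> < 1\<close> let \<open>u = 1 - t\<close> be the square root of \<open>1 - S\<^sup>2\<close> that commutes with \<open>S\<close>.  Then
  \<open>S \<plusminus> i u\<close> are isometric, so \<open>u\<close>, a multiple of their difference, is a contraction, and so is
  \<open>u\<^sup>2 = 1 - S\<^sup>2\<close>.  The case \<open>\<parallel>S\<parallel> = 1\<close> follows by scaling \<open>S\<close>.\<close>

lemma norm_one_minus_square_le:
  assumes sa: "is_adjoint S S" and S1: "norm S \<le> 1"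
  shows "norm (x - S (S x)) \<le> norm x"
proof -
  have strict: "norm (x - S (S x)) \<le> norm x" if sa: "is_adjoint S S" and S1: "norm S < 1" for S x
  proof -
    let ?d = "S o\<^sub>L S"
    interpret lin: bounded_bilinear "(o\<^sub>L) :: ('x \<Rightarrow>\<^sub>L 'x) \<Rightarrow> _ \<Rightarrow> ('x \<Rightarrow>\<^sub>L 'x)"
      by (rule bounded_bilinear_blinfun_compose)
    have assoc: "(f o\<^sub>L g) o\<^sub>L h = f o\<^sub>L (g o\<^sub>L h)" for f g h :: "'x \<Rightarrow>\<^sub>L 'x"
      by (rule blinfun_eqI) simp
    define C where "C = {t. is_adjoint t t} \<inter> {t. t o\<^sub>L S = S o\<^sub>L t}"
    have "norm ?d < 1"
      using norm_blinfun_compose[of S S] S1 mult_left_le[of "norm S" "norm S"]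
      by simp
    then have "\<exists>t\<in>C. 2 *\<^sub>R t - (t o\<^sub>L t) = ?d"
    proof (rule quadratic_equation_solution[OF bounded_bilinear_compose norm_blinfun_compose, rotated 3])
      show "closed C" unfolding C_def
        by (intro closed_Int closed_selfadjoint closed_Collect_eq continuous_intros
            bounded_bilinear.continuous_on[OF bounded_bilinear_blinfun_compose])
      show "0 \<in> C" by (auto simp: C_def is_adjoint_def intro: blinfun_eqI)
      fix t assume "t \<in> C"
      then have t: "is_adjoint t t" "t o\<^sub>L S = S o\<^sub>L t" by (auto simp: C_def)
      have tt: "(t o\<^sub>L t) o\<^sub>L S = S o\<^sub>L (t o\<^sub>L t)"
        unfolding assoc t(2) unfolding assoc[symmetric] t(2) ..
      then show "(1/2) *\<^sub>R (?d + (t o\<^sub>L t)) \<in> C"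
        using is_adjoint_scaleR[OF is_adjoint_add[OF is_adjoint_compose[OF sa sa]
              is_adjoint_compose[OF t(1) t(1)]], of "1/2"]
        unfolding C_def
        using tt by (simp add: lin.scaleR_left lin.scaleR_right lin.add_left lin.add_right assoc)
    qed
    then obtain t where t: "is_adjoint t t" "t o\<^sub>L S = S o\<^sub>L t" "2 *\<^sub>R t - (t o\<^sub>L t) = ?d"
      by (auto simp: C_def)
    have comm: "t (S y) = S (t y)" for y
      using arg_cong[OF t(2), of "\<lambda>f. blinfun_apply f y"] by simp
    have SS: "S (S y) = 2 *\<^sub>R t y - t (t y)" for y
      using arg_cong[OF t(3), of "\<lambda>f. blinfun_apply f y"]
      by (simp add: blinfun.diff_left blinfun.scaleR_left)
    define u where "u y = y - t y" for y
    have u2: "u (u y) = y - S (S y)" for y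
      by (simp add: u_def SS blinfun.diff_right scaleR_2)
    have usa: "ip (u y) z = ip y (u z)" for y z
      by (simp add: u_def ip_diff_left ip_diff_right is_adjoint_left[OF t(1)])
    \<comment> \<open>Only \<open>c = i\<close> and \<open>c = - i\<close> satisfy the two conditions; the mixed terms cancel as \<open>u\<close> and \<open>S\<close> commute.\<close>
    have iso: "norm (S y + c *\<^sub>C u y) = norm y" if c: "cnj c = - c" "c * c = -1" for c y
    proof -
      have "ip (S y + c *\<^sub>C u y) (S y + c *\<^sub>C u y) =
        ip y (S (S y)) + c *\<^sub>C ip y (S (u y)) + (- c) *\<^sub>C ip y (u (S y)) + ip y (u (u y))"
        by (simp add: ip_add_left ip_add_right ip_scaleC_left ip_scaleC_right c scaleC_scaleC usa
            is_adjoint_left[OF sa] scaleC_one scaleC_add_right)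
      also have "u (S y) = S (u y)" by (simp add: u_def comm blinfun.diff_right)
      also have "ip y (S (S y)) + c *\<^sub>C ip y (S (u y)) + (- c) *\<^sub>C ip y (S (u y)) + ip y (u (u y)) =
        ip y (S (S y)) + ip y (u (u y))"
        using scaleC_add_left[of c "-c" "ip y (S (u y))"] scaleC_of_real[of 0 "ip y (S (u y))"] by simp
      finally have "ip (S y + c *\<^sub>C u y) (S y + c *\<^sub>C u y) = ip y y"
        by (simp add: u2 ip_diff_right)
      then show ?thesis by (simp add: norm_eq_sqrt_ip)
    qed
    have unorm: "norm (u y) \<le> norm y" for y
    proof -
      have neg: "(- \<i>) *\<^sub>C u y = - (\<i> *\<^sub>C u y)"
        using scaleC_scaleC[of "-1" "\<i>" "u y"] by simp
      have "2 *\<^sub>R (\<i> *\<^sub>C u y) = (S y + \<i> *\<^sub>C u y) - (S y + (- \<i>) *\<^sub>C u y)"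
        unfolding neg by (simp add: scaleR_2)
      then have "norm (2 *\<^sub>R (\<i> *\<^sub>C u y)) \<le> norm (S y + \<i> *\<^sub>C u y) + norm (S y + (- \<i>) *\<^sub>C u y)"
        by (simp only: norm_triangle_ineq4)
      then show ?thesis by (simp add: iso norm_scaleC)
    qed
    show ?thesis using order_trans[OF unorm[of "u x"] unorm[of x]] unfolding u2 .
  qed
  have "\<forall>\<^sub>F r in at_left (1::real). norm (x - r\<^sup>2 *\<^sub>R S (S x)) \<le> norm x"
    unfolding eventually_at_left_field
  proof (intro exI[of _ 0] conjI allI impI)
    fix r :: real assume r: "0 < r" "r < 1"
    have "r * norm S \<le> r" using S1 r by (simp add: mult_left_le)
    then have "r * norm S < 1" using r by linarith
    then have "norm (r *\<^sub>R S) < 1" using r by simp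
    from strict[OF is_adjoint_scaleR[OF sa] this, of x]
    show "norm (x - r\<^sup>2 *\<^sub>R S (S x)) \<le> norm x"
      by (simp add: blinfun.scaleR_left blinfun.scaleR_right power2_eq_square)
  qed simp
  note ev = this
  have lim: "((\<lambda>r. norm (x - r\<^sup>2 *\<^sub>R S (S x))) \<longlongrightarrow> norm (x - 1\<^sup>2 *\<^sub>R S (S x))) (at_left 1)"
    by (intro tendsto_intros)
  have "norm (x - 1\<^sup>2 *\<^sub>R S (S x)) \<le> norm x"
    by (rule tendsto_upperbound[OF lim ev]) simp
  then show ?thesis by simp
qed

end


section \<open>Representations of the compact operators\<close>

context hilbert_module
begin

text \<open>The bound \<open>1/2\<close> compensates for the constant 4 in \<open>norm_adjoint_le\<close>: it yields \<open>\<parallel>S T\<parallel> < 1\<close>.\<close>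

lemma compact_square_root:
  assumes T: "T \<in> compact_ops act ip" and "norm T < 1/2"
  obtains S t where "S \<in> compact_ops act ip" "is_adjoint T S" "t \<in> compact_ops act ip"
    "is_adjoint t t" "2 *\<^sub>R t - (t o\<^sub>L t) = S o\<^sub>L T"
proof -
  note K = csubspace_compact_ops
  obtain S where S: "S \<in> compact_ops act ip" "is_adjoint T S"
    using compact_adjoint_exists[OF T] .
  have "norm (S o\<^sub>L T) \<le> norm S * norm T" by (rule norm_blinfun_compose)
  also have "\<dots> \<le> (4 * norm T) * norm T"
    by (intro mult_right_mono norm_adjoint_le S) simp
  also have "\<dots> < 4 * (1/2) * (1/2)"
    using assms(2) mult_strict_mono[of "norm T" "1/2" "norm T" "1/2"] by simp
  finally have d: "norm (S o\<^sub>L T) < 1" by simp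
  define C where "C = compact_ops act ip \<inter> {t. is_adjoint t t}"
  have "\<exists>t\<in>C. 2 *\<^sub>R t - (t o\<^sub>L t) = S o\<^sub>L T"
  proof (rule quadratic_equation_solution[OF bounded_bilinear_compose norm_blinfun_compose _ _ _ d])
    show "closed C" unfolding C_def by (intro closed_Int closed_compact_ops closed_selfadjoint)
    show "0 \<in> C" by (simp add: C_def csubspace_0[OF K] is_adjoint_def)
    fix t assume "t \<in> C"
    then have t: "t \<in> compact_ops act ip" "is_adjoint t t" by (auto simp: C_def)
    have "is_adjoint (S o\<^sub>L T) (S o\<^sub>L T)"
      using is_adjoint_compose[OF is_adjoint_sym[OF S(2)] S(2)] .
    then show "(1/2) *\<^sub>R ((S o\<^sub>L T) + (t o\<^sub>L t)) \<in> C"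
      using compact_compose[OF is_adjoint_sym[OF S(2)] T] compact_compose[OF t(2) t(1)] t
      by (simp add: C_def csubspace_add[OF K] csubspace_scaleR[OF K] is_adjoint_scaleR
          is_adjoint_add is_adjoint_compose)
  qed
  then show thesis using that S by (auto simp: C_def)
qed

lemma compact_rep:
  assumes "compact_star_representation act ip \<psi>" "S \<in> compact_ops act ip" "T \<in> compact_ops act ip"
  shows compact_rep_ops: "\<psi> T \<in> bounded_ops"
    and compact_rep_add: "\<psi> (S + T) = \<psi> S + \<psi> T"
    and compact_rep_scaleC: "\<psi> (c *\<^sub>C T) = c *\<^sub>C \<psi> T"
    and compact_rep_compose: "\<psi> (S o\<^sub>L T) = \<psi> S o\<^sub>L \<psi> T"
    and compact_rep_adjoint: "is_adjoint T S \<Longrightarrow> \<psi> S = adj (\<psi> T)"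
  using assms unfolding compact_star_representation_def is_adjoint_def by blast+

lemma compact_rep_scaleR:
  assumes "compact_star_representation act ip \<psi>" "T \<in> compact_ops act ip"
  shows "\<psi> (r *\<^sub>R T) = r *\<^sub>R \<psi> T"
  unfolding scaleR_eq_scaleC by (rule compact_rep_scaleC[OF assms(1,2,2)])

lemma compact_rep_diff:
  assumes "compact_star_representation act ip \<psi>" "S \<in> compact_ops act ip" "T \<in> compact_ops act ip"
  shows "\<psi> (S - T) = \<psi> S - \<psi> T"
proof -
  have "(-1) *\<^sub>C T \<in> compact_ops act ip" by (rule csubspace_scaleC[OF csubspace_compact_ops assms(3)])
  then show ?thesis
    using compact_rep_add[OF assms(1,2), of "(-1) *\<^sub>C T"] compact_rep_scaleC[OF assms, of "-1"] by simp
qed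

text \<open>As for representations of an algebra: the square root \<open>1 - t\<close> of \<open>1 - T\<^sup>* T\<close> is formed among the compact
  operators, and \<open>\<psi>\<close> preserves the equation.\<close>

lemma norm_compact_rep_le:
  assumes \<psi>: "compact_star_representation act ip \<psi>" and T: "T \<in> compact_ops act ip"
  shows "norm (\<psi> T h) \<le> 2 * norm h * norm T"
proof -
  have K: "csubspace (compact_ops act ip)" by (rule csubspace_compact_ops)
  have small: "norm (\<psi> T h) \<le> norm h" if T: "T \<in> compact_ops act ip" "norm T < 1/2" for T
  proof -
    obtain S t where S: "S \<in> compact_ops act ip" "is_adjoint T S"
      and t: "t \<in> compact_ops act ip" "is_adjoint t t" "2 *\<^sub>R t - (t o\<^sub>L t) = S o\<^sub>L T"
      using compact_square_root[OF T] .
    have tt: "t o\<^sub>L t \<in> compact_ops act ip" by (rule compact_compose[OF t(2,1)])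
    note ops = compact_rep_ops[OF \<psi> T(1) T(1)] compact_rep_ops[OF \<psi> t(1) t(1)]
    have sa: "cinner (\<psi> t x) y = cinner x (\<psi> t y)" for x y
      using compact_rep_adjoint[OF \<psi> t(1,1,2)] cinner_adj_right[OF ops(2), of x y] by simp
    have "cinner (\<psi> T h) (\<psi> T h) = cinner h (\<psi> (S o\<^sub>L T) h)"
      by (simp add: compact_rep_compose[OF \<psi> S(1) T(1)] compact_rep_adjoint[OF \<psi> S(1) T(1) S(2)]
          cinner_adj_right[OF ops(1)])
    also have "\<psi> (S o\<^sub>L T) h = 2 *\<^sub>R \<psi> t h - \<psi> t (\<psi> t h)"
      unfolding t(3)[symmetric] compact_rep_diff[OF \<psi> csubspace_scaleR[OF K t(1)] tt]
        compact_rep_scaleR[OF \<psi> t(1)] compact_rep_compose[OF \<psi> t(1,1)]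
      by (simp add: blinfun.diff_left blinfun.scaleR_left)
    finally show ?thesis
      by (intro norm_le_of_square_root[of "blinfun_apply (\<psi> t)"] sa)
  qed
  have "1/2 * norm (\<psi> T h) \<le> norm h * norm T"
  proof (rule bound_by_scaling)
    fix r :: real assume "r > 0" "r * norm T < 1/2"
    then show "r * norm (\<psi> T h) \<le> norm h"
      using small[of "r *\<^sub>R T"] csubspace_scaleR[OF K T]
      by (simp add: compact_rep_scaleR[OF \<psi> T] blinfun.scaleR_left)
  qed auto
  then show ?thesis by simp
qed

lemma compact_rep_unique:
  fixes \<psi> \<psi>' :: "('x \<Rightarrow>\<^sub>L 'x) \<Rightarrow> 'k::complex_hilbert \<Rightarrow>\<^sub>L 'k"
  assumes \<psi>: "compact_star_representation act ip \<psi>" and \<psi>': "compact_star_representation act ip \<psi>'"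
    and eq: "\<And>x y. \<psi> (rank_one_op act ip x y) = \<psi>' (rank_one_op act ip x y)"
    and T: "T \<in> compact_ops act ip"
  shows "\<psi> T = \<psi>' T"
proof (rule blinfun_eqI)
  fix h
  let ?K = "compact_ops act ip"
  note K = csubspace_compact_ops
  have cont: "continuous_on ?K (\<lambda>T. blinfun_apply (\<psi> T) h)"
    if "compact_star_representation act ip \<psi>" for \<psi> :: "('x \<Rightarrow>\<^sub>L 'x) \<Rightarrow> 'k \<Rightarrow>\<^sub>L 'k"
  proof (rule lipschitz_on_continuous_on)
    show "(2 * norm h)-lipschitz_on ?K (\<lambda>T. \<psi> T h)"
    proof (rule lipschitz_onI)
      fix S T assume ST: "S \<in> ?K" "T \<in> ?K"
      show "dist (\<psi> S h) (\<psi> T h) \<le> 2 * norm h * dist S T"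
        using norm_compact_rep_le[OF that csubspace_diff[OF K ST], of h]
        by (simp add: dist_norm compact_rep_diff[OF that ST] blinfun.diff_left)
    qed simp
  qed
  let ?C = "{T \<in> ?K. \<psi> T h - \<psi>' T h = 0}"
  have "?K \<subseteq> ?C"
  proof (rule compact_ops_minimal)
    show "rank_one_op act ip x y \<in> ?C" for x y by (simp add: rank_one_compact eq)
    show "closed ?C"
      by (intro continuous_closed_preimage_constant continuous_intros cont \<psi> \<psi>' closed_compact_ops)
    have zero: "\<psi> 0 = 0" if "compact_star_representation act ip \<psi>"
      for \<psi> :: "('x \<Rightarrow>\<^sub>L 'x) \<Rightarrow> 'k \<Rightarrow>\<^sub>L 'k"
      using compact_rep_add[OF that csubspace_0[OF K] csubspace_0[OF K]] by simp
    show "csubspace ?C"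
      by (rule csubspaceI)
         (auto simp: csubspace_0[OF K] csubspace_add[OF K] csubspace_scaleC[OF K] zero[OF \<psi>] zero[OF \<psi>']
           compact_rep_add[OF \<psi>] compact_rep_add[OF \<psi>'] compact_rep_scaleC[OF \<psi>]
           compact_rep_scaleC[OF \<psi>'] blinfun.add_left scaleC_blinfun.rep_eq)
  qed
  then show "\<psi> T h = \<psi>' T h" using T by auto
qed

end

text \<open>A representation \<open>\<Pi>\<close> of the module over \<open>\<pi>\<close> that is nondegenerate on the side of its codomain.\<close>

locale module_rep = hilbert_module act ip + star_rep \<pi>
  for act :: "'x::{complex_normed_vector, complete_space} \<Rightarrow> 'a::cstar_algebra \<Rightarrow> 'x"
    and ip :: "'x \<Rightarrow> 'x \<Rightarrow> 'a"
    and \<pi> :: "'a \<Rightarrow> 'h::complex_hilbert \<Rightarrow>\<^sub>L 'h" +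
  fixes \<Pi>\<^sub>X :: "'x \<Rightarrow> 'h \<Rightarrow>\<^sub>L 'k::complex_hilbert"
  assumes rep_map: "op_valued_map ip \<pi> \<Pi>\<^sub>X"
    and total: "closed_cspan {\<Pi>\<^sub>X x h | x h. True} = UNIV"
begin

lemma map_ops: "\<Pi>\<^sub>X x \<in> bounded_ops"
  using rep_map by (auto simp: op_valued_map_def)

lemma adj_map_apply: "adj (\<Pi>\<^sub>X x) (\<Pi>\<^sub>X y h) = \<pi> (ip x y) h"
proof -
  have "adj (\<Pi>\<^sub>X x) o\<^sub>L \<Pi>\<^sub>X y = \<pi> (ip x y)"
    using rep_map by (simp add: op_valued_map_def)
  from arg_cong[OF this, of "\<lambda>T. blinfun_apply T h"] show ?thesis by simp
qed

lemma cinner_map: "cinner (\<Pi>\<^sub>X x h) (\<Pi>\<^sub>X y k) = cinner h (\<pi> (ip x y) k)"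
  by (simp add: cinner_adj_right[OF map_ops, symmetric] adj_map_apply)

lemma eq_by_total:
  assumes "\<And>z k. cinner (\<Pi>\<^sub>X z k) u = cinner (\<Pi>\<^sub>X z k) v" shows "u = v"
  using assms by (intro cinner_eq_on_total[OF total]) auto

text \<open>Linearity and compatibility with the module action follow from the inner product relation, because
  the vectors \<open>\<Pi>(z) k\<close> separate points.\<close>

lemma map_add: "\<Pi>\<^sub>X (x + y) h = \<Pi>\<^sub>X x h + \<Pi>\<^sub>X y h"
  by (rule eq_by_total)
     (simp add: cinner_map cinner_add_right ip_add_right clinear_add[OF lin] blinfun.add_left)

lemma map_scaleC: "\<Pi>\<^sub>X (c *\<^sub>C x) h = c *\<^sub>C \<Pi>\<^sub>X x h"
  by (rule eq_by_total)
     (simp add: cinner_map cinner_scaleC_right ip_scaleC_right clinear_scaleC[OF lin] scaleC_blinfun.rep_eq)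

lemma map_act: "\<Pi>\<^sub>X (act x a) h = \<Pi>\<^sub>X x (\<pi> a h)"
  by (rule eq_by_total) (simp add: cinner_map ip_act_right mult)

lemma norm_map_le: "norm (\<Pi>\<^sub>X x h) \<le> norm x * norm h"
proof (rule power2_le_imp_le)
  have "(norm (\<Pi>\<^sub>X x h))\<^sup>2 = cmod (cinner (\<Pi>\<^sub>X x h) (\<Pi>\<^sub>X x h))"
    by (simp add: cinner_self norm_power)
  also have "\<dots> \<le> norm h * norm (\<pi> (ip x x) h)"
    unfolding cinner_map by (rule cauchy_schwarz)
  also have "\<dots> \<le> norm h * (norm (ip x x) * norm h)"
    by (intro mult_left_mono norm_rep_le) simp
  finally show "(norm (\<Pi>\<^sub>X x h))\<^sup>2 \<le> (norm x * norm h)\<^sup>2"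
    by (simp add: norm_ip_self power2_eq_square mult_ac)
qed simp

lemma bounded_linear_map: "bounded_linear (\<lambda>x. \<Pi>\<^sub>X x h)"
  by (rule bounded_linear_intro[of _ "norm h"])
     (simp_all add: map_add norm_map_le scaleR_eq_scaleC map_scaleC)

text \<open>The relation \<open>R = \<rho>(T)\<close>, before existence of \<open>\<rho>(T)\<close> is known.\<close>

definition implements :: "('x \<Rightarrow>\<^sub>L 'x) \<Rightarrow> ('k \<Rightarrow>\<^sub>L 'k) \<Rightarrow> bool" where
  "implements T R \<longleftrightarrow> R \<in> bounded_ops \<and> (\<forall>z h. R (\<Pi>\<^sub>X z h) = \<Pi>\<^sub>X (T z) h)"

lemma implements_unique: "implements T R \<Longrightarrow> implements T R' \<Longrightarrow> R = R'"
  by (rule bounded_ops_eq_on_total[OF total]) (auto simp: implements_def)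

lemma implements_add: "implements T R \<Longrightarrow> implements T' R' \<Longrightarrow> implements (T + T') (R + R')"
  by (auto simp: implements_def blinfun.add_left map_add bounded_ops_scaleC scaleC_add_right
      intro!: bounded_opsI)

lemma implements_scaleC: "implements T R \<Longrightarrow> implements (c *\<^sub>C T) (c *\<^sub>C R)"
  by (auto simp: implements_def scaleC_blinfun.rep_eq map_scaleC bounded_ops_scaleC scaleC_scaleC
      mult.commute intro!: bounded_opsI)

lemma implements_scaleR: "implements T R \<Longrightarrow> implements (r *\<^sub>R T) (r *\<^sub>R R)"
  unfolding scaleR_eq_scaleC by (rule implements_scaleC)

lemma implements_diff: "implements T R \<Longrightarrow> implements T' R' \<Longrightarrow> implements (T - T') (R - R')"
  using implements_add[of T R "(-1) *\<^sub>C T'" "(-1) *\<^sub>C R'"] implements_scaleC[of T' R' "-1"] by simp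

lemma implements_compose: "implements T R \<Longrightarrow> implements T' R' \<Longrightarrow> implements (T o\<^sub>L T') (R o\<^sub>L R')"
  by (simp add: implements_def compose_in_bounded_ops)

lemma implements_adjoint:
  assumes "implements T R" "implements S Q" "is_adjoint T S"
  shows "Q = adj R"
proof -
  have R: "R \<in> bounded_ops" using assms(1) by (simp add: implements_def)
  show ?thesis
  proof (rule bounded_ops_eq_on_total[OF total])
    show "Q \<in> bounded_ops" "adj R \<in> bounded_ops"
      using assms(2) adj_in_bounded_ops[OF R] by (simp_all add: implements_def)
    fix v assume "v \<in> {\<Pi>\<^sub>X x h | x h. True}"
    then obtain y k where v: "v = \<Pi>\<^sub>X y k" by blast
    show "Q v = adj R v"
    proof (rule eq_by_total)
      fix z h
      have "cinner (\<Pi>\<^sub>X z h) (Q v) = cinner (R (\<Pi>\<^sub>X z h)) v"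
        using assms by (simp add: v implements_def cinner_map is_adjoint_left[OF assms(3)])
      then show "cinner (\<Pi>\<^sub>X z h) (Q v) = cinner (\<Pi>\<^sub>X z h) (adj R v)"
        by (simp add: cinner_adj_right[OF R])
    qed
  qed
qed

lemma implements_rank_one: "implements (rank_one_op act ip x y) (\<Pi>\<^sub>X x o\<^sub>L adj (\<Pi>\<^sub>X y))"
  by (simp add: implements_def compose_in_bounded_ops map_ops adj_in_bounded_ops adj_map_apply
      rank_one_apply map_act)

text \<open>Let \<open>1 - t\<close> be the square root of \<open>1 - T\<^sup>* T\<close>.  On \<open>u = \<Pi>(z) h\<close> put \<open>w = \<Pi>((1 - t) z) h\<close>.  Then
  \<open>\<langle>u, u'\<rangle> = \<langle>R u, R u'\<rangle> + \<langle>w, w'\<rangle>\<close> on such pairs, hence on their span by sesquilinearity, and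
  \<open>\<parallel>R u\<parallel> \<le> \<parallel>u\<parallel>\<close> on a dense set.  Working with pairs \<open>(u, w)\<close> spares a proof
  that \<open>w\<close> is a function of \<open>u\<close>.\<close>

lemma implements_norm_le:
  assumes T: "T \<in> compact_ops act ip" and R: "implements T R"
  shows "norm R \<le> 2 * norm T"
proof -
  have small: "norm (R u) \<le> norm u"
    if T: "T \<in> compact_ops act ip" "norm T < 1/2" and R: "implements T R" for T R u
  proof -
    obtain S t where S: "is_adjoint T S" and t: "is_adjoint t t" "2 *\<^sub>R t - (t o\<^sub>L t) = S o\<^sub>L T"
      using compact_square_root[OF T] .
    define G where "G = {(\<Pi>\<^sub>X z h, \<Pi>\<^sub>X (z - t z) h) | z h. True}"
    define B where "B p q = cinner (fst p) (fst q) - cinner (R (fst p)) (R (fst q)) - cinner (snd p) (snd q)"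
      for p q :: "'k \<times> 'k"
    have gen: "B p q = 0" if pq: "p \<in> G" "q \<in> G" for p q
    proof -
      obtain z h z' h' where p: "p = (\<Pi>\<^sub>X z h, \<Pi>\<^sub>X (z - t z) h)" and q: "q = (\<Pi>\<^sub>X z' h', \<Pi>\<^sub>X (z' - t z') h')"
        using pq unfolding G_def by blast
      have "S (T z') = 2 *\<^sub>R t z' - t (t z')"
        using arg_cong[OF t(2), of "\<lambda>f. blinfun_apply f z'"]
        by (simp add: blinfun.diff_left blinfun.scaleR_left)
      then have "ip z z' - ip (T z) (T z') - ip (z - t z) (z' - t z') = 0"
        by (simp add: is_adjoint_left[OF S] is_adjoint_left[OF t(1)] ip_diff_left ip_diff_right
            ip_scaleR_right ip_add_right scaleR_2 blinfun.diff_right)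
      then have "\<pi> (ip z z') - \<pi> (ip (T z) (T z')) - \<pi> (ip (z - t z) (z' - t z')) = 0"
        unfolding clinear_diff[OF lin, symmetric] using clinear_diff[OF lin, of 0 0] by simp
      from arg_cong[OF this, of "\<lambda>f. cinner h (blinfun_apply f h')"]
      show ?thesis using R
        by (simp add: B_def p q implements_def cinner_map blinfun.diff_left cinner_diff_right)
    qed
    have "B (p + p') q = B p q + B p' q" "B (r *\<^sub>R p) q = of_real r * B p q"
      "B p (q + q') = B p q + B p q'" "B p (r *\<^sub>R q) = of_real r * B p q"
      "B 0 q = 0" "B p 0 = 0" for p p' q q' r
      by (simp_all add: B_def blinfun.add_right blinfun.scaleR_right cinner_add_left cinner_add_right
          cinner_scaleR_left cinner_scaleR_right algebra_simps)
    then have sub1: "subspace {p. B p q = 0}" and sub2: "subspace {q. B p q = 0}" for p q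
      by (simp_all add: subspace_def)
    have "B p q = 0" if "p \<in> span G" "q \<in> G" for p q
      using span_induct[OF that(1) sub1] gen that(2) by blast
    then have B0: "B p q = 0" if "p \<in> span G" "q \<in> span G" for p q
      using span_induct[OF that(2) sub2] that(1) by blast
    have contr: "norm (R u) \<le> norm u" if "(u, w) \<in> span G" for u w
    proof -
      have "cinner u u = cinner (R u) (R u) + cinner w w"
        using B0[OF that that] by (simp add: B_def algebra_simps)
      from arg_cong[OF this, of Re] have "(norm u)\<^sup>2 = (norm (R u))\<^sup>2 + (norm w)\<^sup>2"
        by (simp add: cinner_self flip: of_real_power)
      then have "(norm (R u))\<^sup>2 \<le> (norm u)\<^sup>2" by simp
      then show ?thesis by (rule power2_le_imp_le) simp
    qed
    let ?M = "{\<Pi>\<^sub>X x h | x h. True}"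
    have "cspan ?M = span ?M"
    proof (rule cspan_eq_real_span)
      fix c x assume "x \<in> ?M"
      then obtain z h where "x = \<Pi>\<^sub>X z h" by blast
      then have "c *\<^sub>C x = \<Pi>\<^sub>X (c *\<^sub>C z) h" by (simp add: map_scaleC)
      then show "c *\<^sub>C x \<in> ?M" by blast
    qed
    moreover have "span ?M \<subseteq> fst ` span G"
    proof (rule span_minimal)
      show "?M \<subseteq> fst ` span G"
        using span_superset[of G] by (force simp: G_def)
      show "subspace (fst ` span G)"
        by (rule linear_subspace_image[OF linear_fst subspace_span])
    qed
    moreover have "closure (fst ` span G) \<subseteq> {u. norm (R u) \<le> norm u}"
      using contr
      by (intro closure_minimal closed_Collect_le continuous_intros) auto
    ultimately show ?thesis
      using total closure_mono unfolding closed_cspan_def by blast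
  qed
  have "norm (R u) \<le> 2 * norm T * norm u" for u
  proof -
    have "1/2 * norm (R u) \<le> norm u * norm T"
    proof (rule bound_by_scaling)
      fix r :: real assume "r > 0" "r * norm T < 1/2"
      then show "r * norm (R u) \<le> norm u"
        using small[OF csubspace_scaleR[OF csubspace_compact_ops T] _ implements_scaleR[OF R], of r u]
        by (simp add: blinfun.scaleR_left)
    qed auto
    then show ?thesis by (simp add: mult_ac)
  qed
  then show ?thesis using norm_blinfun_bound[of "2 * norm T" R] by simp
qed

text \<open>The pairs \<open>(T, \<rho>(T))\<close> form a closed bounded graph, so its domain is a closed subspace, and it
  contains the rank one operators.\<close>

lemma implements_exists:
  assumes "T \<in> compact_ops act ip"
  shows "\<exists>R. implements T R"
proof -
  let ?K = "compact_ops act ip"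
  note K = csubspace_compact_ops
  define P where "P = {p. fst p \<in> ?K \<and> implements (fst p) (snd p)}"
  have P: "(T, R) \<in> P \<longleftrightarrow> T \<in> ?K \<and> implements T R" for T R by (simp add: P_def)
  have "?K \<subseteq> fst ` P"
  proof (rule compact_ops_minimal)
    show "rank_one_op act ip x y \<in> fst ` P" for x y
      using P rank_one_compact implements_rank_one by (metis fst_conv image_eqI)
    show "csubspace (fst ` P)"
    proof (rule csubspaceI)
      have "(0, 0) \<in> P"
        using implements_scaleR[OF implements_rank_one, of 0] by (simp add: P csubspace_0[OF K])
      then show "0 \<in> fst ` P" by force
      fix T T' assume "T \<in> fst ` P" "T' \<in> fst ` P"
      then obtain R R' where R: "(T, R) \<in> P" "(T', R') \<in> P" by auto
      then have "(T + T', R + R') \<in> P"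
        unfolding P by (simp add: csubspace_add[OF K] implements_add)
      then show "T + T' \<in> fst ` P" by force
      fix c
      have "(c *\<^sub>C T, c *\<^sub>C R) \<in> P"
        using R(1) unfolding P by (simp add: csubspace_scaleC[OF K] implements_scaleC)
      then show "c *\<^sub>C T \<in> fst ` P" by force
    qed
    show "closed (fst ` P)"
    proof (rule closed_domain_of_bounded_graph)
      have "P = (?K \<times> UNIV) \<inter> ({p. \<forall>c x. blinfun_apply (snd p) (c *\<^sub>C x) = c *\<^sub>C blinfun_apply (snd p) x} \<inter>
          {p. \<forall>z h. blinfun_apply (snd p) (\<Pi>\<^sub>X z h) = \<Pi>\<^sub>X (blinfun_apply (fst p) z) h})"
        unfolding P_def implements_def using bounded_ops_scaleC bounded_opsI by (auto simp: mem_Times_iff)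
      then show "closed P"
        by (simp only:) (intro closed_Int closed_Times closed_compact_ops closed_UNIV closed_Collect_all
            closed_Collect_eq continuous_intros bounded_linear.continuous_on[OF bounded_linear_map])
      show "p - q \<in> P" if "p \<in> P" "q \<in> P" for p q
        using that P by (cases p; cases q) (simp add: csubspace_diff[OF K] implements_diff)
      show "norm R \<le> 2 * norm T" if "(T, R) \<in> P" for T R
        using that unfolding P by (simp add: implements_norm_le)
    qed
  qed
  then obtain R where "(T, R) \<in> P" using assms by auto
  then show ?thesis unfolding P by blast
qed

definition compact_action :: "('x \<Rightarrow>\<^sub>L 'x) \<Rightarrow> 'k \<Rightarrow>\<^sub>L 'k" where
  "compact_action T = (THE R. implements T R)"

lemma compact_action_eq: "implements T R \<Longrightarrow> compact_action T = R"
  unfolding compact_action_def using implements_unique by blast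

lemma implements_compact_action: "T \<in> compact_ops act ip \<Longrightarrow> implements T (compact_action T)"
  using implements_exists compact_action_eq by metis

text \<open>Multiplicativity survives the compression by \<open>W\<close> because \<open>W W\<^sup>* = 1\<close>.\<close>

lemma induced_rep_eq:
  fixes W :: "'l::complex_hilbert \<Rightarrow>\<^sub>L 'k"
  assumes W: "coisometry W" and T: "T \<in> compact_ops act ip"
  shows "induced_rep act ip \<Pi>\<^sub>X W T = adj W o\<^sub>L compact_action T o\<^sub>L W"
proof -
  let ?K = "compact_ops act ip"
  note K = csubspace_compact_ops
  have Wop: "W \<in> bounded_ops" and "W o\<^sub>L adj W = id_blinfun"
    using W by (auto simp: coisometry_def)
  from arg_cong[OF this(2), of "\<lambda>f. blinfun_apply f _"] have WW: "W (adj W k) = k" for k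
    by simp
  define \<psi> where "\<psi> = restrict (\<lambda>T. adj W o\<^sub>L compact_action T o\<^sub>L W) ?K"
  have app: "\<psi> T h = adj W (compact_action T (W h))" if "T \<in> ?K" for T h
    using that by (simp add: \<psi>_def)
  note impl = implements_compact_action
  have ext: "\<psi> \<in> extensional ?K" by (simp add: \<psi>_def)
  have star: "compact_star_representation act ip \<psi>"
    unfolding compact_star_representation_def
  proof (intro conjI ballI allI impI)
    have ops: "compact_action T \<in> bounded_ops" if "T \<in> ?K" for T
      using impl[OF that] by (simp add: implements_def)
    then have psi_ops: "\<psi> T \<in> bounded_ops" if "T \<in> ?K" for T
      using that by (simp add: \<psi>_def compose_in_bounded_ops adj_in_bounded_ops Wop)
    then show "\<psi> ` ?K \<subseteq> bounded_ops" by blast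
    fix S T assume ST: "S \<in> ?K" "T \<in> ?K"
    show "\<psi> (S + T) = \<psi> S + \<psi> T"
      by (rule blinfun_eqI)
         (simp add: app ST csubspace_add[OF K] compact_action_eq[OF implements_add[OF impl impl]]
           blinfun.add_left blinfun.add_right)
    obtain S' where "is_adjoint S S'" using compact_adjoint_exists[OF ST(1)] .
    then show "\<psi> (S o\<^sub>L T) = \<psi> S o\<^sub>L \<psi> T"
      by (intro blinfun_eqI)
         (simp add: app ST compact_compose compact_action_eq[OF implements_compose[OF impl impl]] WW)
    assume "\<forall>x y. ip (T x) y = ip x (S y)"
    then have "is_adjoint T S" by (simp add: is_adjoint_def)
    then have adj: "compact_action S = adj (compact_action T)"
      by (rule implements_adjoint[OF impl impl, OF ST(2,1)])
    show "\<psi> S = adj (\<psi> T)"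
      by (rule adj_eqI[symmetric])
         (simp add: app ST adj cinner_adj_left[OF Wop] cinner_adj_right[OF Wop] cinner_adj_right[OF ops])
  next
    fix c T assume T: "T \<in> ?K"
    show "\<psi> (c *\<^sub>C T) = c *\<^sub>C \<psi> T"
      by (rule blinfun_eqI)
         (simp add: app T csubspace_scaleC[OF K] compact_action_eq[OF implements_scaleC[OF impl]]
           scaleC_blinfun.rep_eq bounded_ops_scaleC[OF adj_in_bounded_ops[OF Wop]])
  qed
  have rank_one: "\<psi> (rank_one_op act ip x y) = adj W o\<^sub>L \<Pi>\<^sub>X x o\<^sub>L adj (\<Pi>\<^sub>X y) o\<^sub>L W" for x y
    by (rule blinfun_eqI)
       (simp add: app rank_one_compact compact_action_eq[OF implements_rank_one])
  have "induced_rep act ip \<Pi>\<^sub>X W = \<psi>"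
    unfolding induced_rep_def
  proof (rule the_equality)
    show "\<psi> \<in> extensional ?K \<and> compact_star_representation act ip \<psi> \<and>
        (\<forall>x y. \<psi> (rank_one_op act ip x y) = adj W o\<^sub>L \<Pi>\<^sub>X x o\<^sub>L adj (\<Pi>\<^sub>X y) o\<^sub>L W)"
      using ext star rank_one by blast
    fix \<psi>' :: "('x \<Rightarrow>\<^sub>L 'x) \<Rightarrow> 'l \<Rightarrow>\<^sub>L 'l"
    assume \<psi>': "\<psi>' \<in> extensional ?K \<and> compact_star_representation act ip \<psi>' \<and>
        (\<forall>x y. \<psi>' (rank_one_op act ip x y) = adj W o\<^sub>L \<Pi>\<^sub>X x o\<^sub>L adj (\<Pi>\<^sub>X y) o\<^sub>L W)"
    show "\<psi>' = \<psi>"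
    proof (rule extensionalityI[of _ ?K])
      fix T assume "T \<in> ?K"
      then show "\<psi>' T = \<psi> T"
        by (rule compact_rep_unique[rotated -1]) (simp_all add: \<psi>' star rank_one)
    qed (simp_all add: \<psi>' ext)
  qed
  then show ?thesis using T by (simp add: \<psi>_def)
qed

end


section \<open>Approximate units\<close>

text \<open>Self-adjoint multipliers of the algebra are self-adjoint operators on this module, which gives access
  to elements of the unitization, such as \<open>1 - g\<close> below, without forming it.\<close>

lemma self_hilbert_module:
  "hilbert_module (\<lambda>x a. x * a) (\<lambda>x y. star x * (y::'a::cstar_algebra))"
proof
  show "star_positive (star x * x)" for x :: 'a
    unfolding star_positive_def by blast
  show "star x * x = 0 \<Longrightarrow> x = 0" for x :: 'a
    using norm_star_mult_self[of x] by simp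
  show "norm x = sqrt (norm (star x * x))" for x :: 'a
    by (simp add: norm_star_mult_self)
qed (simp_all add: distrib_left distrib_right mult.assoc mult_scaleC_left mult_scaleC_right
    star_mult star_star)

lemma norm_minus_square_mult_le:
  fixes d :: "'a::cstar_algebra"
  assumes d: "star d = d" and "norm d \<le> 1"
  shows "norm (x - d * d * x) \<le> norm x"
proof -
  interpret A: hilbert_module "\<lambda>x a. x * a" "\<lambda>x y. star x * (y::'a)"
    by (rule self_hilbert_module)
  let ?S = "Blinfun (\<lambda>x. d * x)"
  have S: "blinfun_apply ?S = (\<lambda>x. d * x)"
    by (simp add: bounded_linear_Blinfun_apply bounded_linear_mult_right)
  have "norm ?S \<le> 1"
  proof (rule norm_blinfun_bound)
    show "norm (?S x) \<le> 1 * norm x" for x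
      using norm_mult_ineq[of d x] mult_right_mono[OF assms(2), of "norm x"] by (simp add: S)
  qed simp
  moreover have "A.is_adjoint ?S ?S"
    by (simp add: A.is_adjoint_def S star_mult d mult.assoc)
  ultimately show ?thesis
    using A.norm_one_minus_square_le[of ?S x] by (simp add: S mult.assoc)
qed

text \<open>Here \<open>g + g - g g = 1 - (1 - g)\<^sup>2\<close>; the norm of an element \<open>b\<close> is recovered from the action on \<open>b\<^sup>*\<close>.\<close>

lemma norm_double_minus_square_le:
  fixes g :: "'a::cstar_algebra"
  assumes g: "star g = g" and contr: "\<And>x. norm (x - g * x) \<le> norm x"
  shows "norm (g + g - g * g) \<le> 1"
proof -
  interpret A: hilbert_module "\<lambda>x a. x * a" "\<lambda>x y. star x * (y::'a)"
    by (rule self_hilbert_module)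
  let ?S = "Blinfun (\<lambda>x. x - g * x)"
  have S: "blinfun_apply ?S = (\<lambda>x. x - g * x)"
    by (intro bounded_linear_Blinfun_apply bounded_linear_sub bounded_linear_ident bounded_linear_mult_right)
  have "norm ?S \<le> 1"
    by (rule norm_blinfun_bound) (simp_all add: S contr)
  moreover have "A.is_adjoint ?S ?S"
    by (simp add: A.is_adjoint_def S star_mult star_diff g left_diff_distrib right_diff_distrib mult.assoc)
  ultimately have le: "norm (x - ?S (?S x)) \<le> norm x" for x
    by (intro A.norm_one_minus_square_le)
  let ?b = "g + g - g * g"
  have b: "x - ?S (?S x) = ?b * x" for x
    by (simp add: S algebra_simps)
  have "norm ?b * norm ?b = norm (star (star ?b) * star ?b)"
    by (simp add: norm_star_mult_self power2_eq_square)
  also have "\<dots> \<le> norm ?b" using le[of "star ?b"] unfolding b by (simp add: star_star)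
  finally show ?thesis
    by (metis mult_le_cancel_left_pos mult.right_neutral norm_ge_zero order_le_less zero_less_one_class.zero_le_one)
qed

lemma le_of_square_le_mult: "(y::real)\<^sup>2 \<le> x * y \<Longrightarrow> 0 \<le> x \<Longrightarrow> y \<le> x"
  by (metis mult_le_cancel_right not_le order_trans power2_eq_square)

context star_rep
begin

text \<open>The contractions of the form \<open>w = 1 - e\<close>, described by \<open>e\<close>.  They are closed under products, where
  \<open>(1 - e) (1 - f) = 1 - (e + f - e f)\<close>, and under adjoints.  The second condition records that \<open>\<pi>\<close>
  maps \<open>w\<close> to a contraction as well.\<close>

definition complement_contracts :: "'a \<Rightarrow> bool" where
  "complement_contracts e \<longleftrightarrow>
     (\<forall>x. norm (x - e * x) \<le> norm x) \<and> (\<forall>h. norm (h - \<pi> e h) \<le> norm h)"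

lemma complement_apply:
  "x - (e + f - e * f) * x = (x - f * x) - e * (x - f * (x::'a))"
  "h - \<pi> (e + f - e * f) h = (h - \<pi> f h) - \<pi> e (h - \<pi> f h)"
  by (simp_all add: algebra_simps clinear_add[OF lin] clinear_diff[OF lin] mult blinfun.add_left
      blinfun.diff_left blinfun.diff_right)

lemma complement_contracts_compose:
  assumes "complement_contracts e" "complement_contracts f"
  shows "complement_contracts (e + f - e * f)"
  unfolding complement_contracts_def complement_apply
  using assms unfolding complement_contracts_def by (meson order_trans)

lemma complement_contracts_zero: "complement_contracts 0"
  using clinear_diff[OF lin, of 0 0] by (simp add: complement_contracts_def)

lemma complement_contracts_star:
  assumes "complement_contracts e"
  shows "complement_contracts (star e)"
  unfolding complement_contracts_def
proof (intro conjI allI)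
  fix x :: 'a
  define y where "y = x - star e * x"
  have "(norm y)\<^sup>2 = norm (star x * (y - e * y))"
    by (simp add: norm_star_mult_self[symmetric])
       (simp add: y_def star_diff star_mult star_star algebra_simps)
  also have "\<dots> \<le> norm x * norm (y - e * y)" using norm_mult_ineq[of "star x"] by simp
  also have "\<dots> \<le> norm x * norm y"
    using assms by (simp add: complement_contracts_def mult_left_mono)
  finally show "norm (x - star e * x) \<le> norm x"
    unfolding y_def[symmetric] by (rule le_of_square_le_mult) simp
next
  fix h
  define y where "y = h - \<pi> (star e) h"
  have "(norm y)\<^sup>2 = cmod (cinner y y)" by (simp add: cinner_self norm_power)
  also have "cinner y y = cinner h (y - \<pi> e y)"
    by (simp add: y_def cinner_diff_left cinner_diff_right cinner_rep_left star_star blinfun.diff_right)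
  also have "cmod \<dots> \<le> norm h * norm (y - \<pi> e y)" by (rule cauchy_schwarz)
  also have "\<dots> \<le> norm h * norm y"
    using assms by (simp add: complement_contracts_def mult_left_mono)
  finally show "norm (h - \<pi> (star e) h) \<le> norm h"
    unfolding y_def[symmetric] by (rule le_of_square_le_mult) simp
qed

lemma norm_minus_square_apply_le:
  assumes d: "star d = d" and "norm d \<le> 1"
  shows "(norm (h - \<pi> d (\<pi> d h)))\<^sup>2 \<le> (norm h)\<^sup>2 - (norm (\<pi> d h))\<^sup>2"
proof -
  have "norm (\<pi> d (\<pi> d h)) \<le> norm (\<pi> d h)"
    using norm_rep_le[of d "\<pi> d h"] mult_right_mono[OF assms(2), of "norm (\<pi> d h)"] by simp
  then have "(norm (\<pi> d (\<pi> d h)))\<^sup>2 \<le> (norm (\<pi> d h))\<^sup>2" by (rule power_mono) simp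
  moreover have "Re (cinner h (\<pi> d (\<pi> d h))) = (norm (\<pi> d h))\<^sup>2"
    using arg_cong[OF cinner_rep_left[of d h "\<pi> d h"], of Re] by (simp add: d cinner_self flip: of_real_power)
  ultimately show ?thesis unfolding norm_diff_square by linarith
qed

lemma complement_contracts_square:
  assumes "star d = d" "norm d \<le> 1"
  shows "complement_contracts (d * d)"
  unfolding complement_contracts_def
proof (intro conjI allI)
  show "norm (x - d * d * x) \<le> norm x" for x by (rule norm_minus_square_mult_le[OF assms])
  show "norm (h - \<pi> (d * d) h) \<le> norm h" for h
    using norm_minus_square_apply_le[OF assms, of h]
    by (smt (verit) mult blinfun_apply_blinfun_compose norm_ge_zero power2_le_imp_le zero_le_power2)
qed

text \<open>With \<open>D = \<pi>(d)\<close>, \<open>d = r a a\<^sup>*\<close> and \<open>P = 1 - D\<^sup>2\<close>, the powers \<open>P\<^sup>n\<close> annihilate the range of \<open>\<pi>(a)\<close> in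
  the limit.  Let \<open>z\<^sub>n = P\<^sup>n \<pi>(a) h\<close>.  The norms of \<open>z\<^sub>n\<close> decrease by at least what \<open>D z\<^sub>n\<close> contributes,
  so \<open>D z\<^sub>n \<rightarrow> 0\<close>.  This carries over to \<open>q\<^sub>n = \<pi>(a)\<^sup>* z\<^sub>n\<close>, since
  \<open>\<parallel>q\<^sub>n\<parallel>\<^sup>2 = \<langle>z\<^sub>n, D z\<^sub>n\<rangle> / r\<close>, and then to \<open>z\<^sub>n\<close>, since \<open>\<parallel>z\<^sub>n\<parallel>\<^sup>2 = \<langle>h, q\<^sub>2\<^sub>n\<rangle>\<close>.\<close>

lemma complement_annihilates_range:
  assumes "\<epsilon> > 0"
  shows "\<exists>e. complement_contracts e \<and> norm (\<pi> a h - \<pi> e (\<pi> a h)) < \<epsilon>"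
proof -
  \<comment> \<open>The scaling ensures \<open>norm d \<le> 1\<close>.\<close>
  define r where "r = 1 / ((norm a)\<^sup>2 + 1)"
  have r: "r > 0" by (simp add: r_def add_nonneg_pos)
  define d where "d = r *\<^sub>R (a * star a)"
  have d: "star d = d" by (simp add: d_def star_scaleR star_mult star_star)
  have "norm d = r * (norm a)\<^sup>2"
    using norm_star_mult_self[of "star a"] r by (simp add: d_def star_star)
  then have d1: "norm d \<le> 1" by (simp add: r_def add_nonneg_pos divide_le_eq)
  define P where "P h = h - \<pi> d (\<pi> d h)" for h
  define z where "z n = (P ^^ n) (\<pi> a h)" for n
  have zS: "z (Suc n) = P (z n)" for n by (simp add: z_def)
  have e: "\<exists>e. complement_contracts e \<and> \<pi> a h - \<pi> e (\<pi> a h) = z n" for n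
  proof (induction n)
    case 0
    show ?case
      using complement_contracts_zero clinear_diff[OF lin, of 0 0]
      by (intro exI[of _ 0]) (simp add: z_def)
  next
    case (Suc n)
    then obtain e where e: "complement_contracts e" "\<pi> a h - \<pi> e (\<pi> a h) = z n" by blast
    show ?case
      using complement_contracts_compose[OF complement_contracts_square[OF d d1] e(1)]
      by (intro exI[of _ "d * d + e - d * d * e"]) (simp only: complement_apply e(2) zS, simp add: P_def mult)
  qed
  have step: "(norm (z (Suc n)))\<^sup>2 \<le> (norm (z n))\<^sup>2 - (norm (\<pi> d (z n)))\<^sup>2" for n
    unfolding zS P_def by (rule norm_minus_square_apply_le[OF d d1])
  have dec: "decseq (\<lambda>n. (norm (z n))\<^sup>2)"
    by (rule decseq_SucI) (smt (verit) step zero_le_power2)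
  then obtain L where "(\<lambda>n. (norm (z n))\<^sup>2) \<longlonglongrightarrow> L"
    using decseq_convergent[of _ 0] by (metis zero_le_power2)
  then have "(\<lambda>n. (norm (z n))\<^sup>2 - (norm (z (Suc n)))\<^sup>2) \<longlonglongrightarrow> L - L"
    by (intro tendsto_diff LIMSEQ_Suc)
  then have diff0: "(\<lambda>n. (norm (z n))\<^sup>2 - (norm (z (Suc n)))\<^sup>2) \<longlonglongrightarrow> 0" by simp
  have "(\<lambda>n. (norm (\<pi> d (z n)))\<^sup>2) \<longlonglongrightarrow> 0"
  proof (rule Lim_null_comparison[OF always_eventually diff0], rule allI)
    show "norm ((norm (\<pi> d (z n)))\<^sup>2) \<le> (norm (z n))\<^sup>2 - (norm (z (Suc n)))\<^sup>2" for n
      using step[of n] by simp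
  qed
  then have Dz: "(\<lambda>n. norm (\<pi> d (z n))) \<longlonglongrightarrow> 0"
    by (simp add: tendsto_power_zero)
  define q where "q n = \<pi> (star a) (z n)" for n
  have "(\<lambda>n. (norm (q n))\<^sup>2) \<longlonglongrightarrow> 0"
  proof (rule Lim_null_comparison[OF always_eventually], rule allI)
    fix n
    have "\<pi> a (q n) = (1 / r) *\<^sub>R \<pi> d (z n)"
      using r by (simp add: q_def d_def clinear_scaleR[OF lin] mult blinfun.scaleR_left)
    then have "cinner (q n) (q n) = cinner (z n) ((1 / r) *\<^sub>R \<pi> d (z n))"
      using cinner_rep_left[of "star a" "z n" "q n"] by (simp add: q_def star_star)
    then have "(norm (q n))\<^sup>2 = cmod (cinner (z n) ((1 / r) *\<^sub>R \<pi> d (z n)))"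
      by (metis cinner_self norm_of_real abs_of_nonneg zero_le_power2)
    also have "\<dots> \<le> norm (z n) * ((1 / r) * norm (\<pi> d (z n)))"
      using cauchy_schwarz[of "z n" "(1 / r) *\<^sub>R \<pi> d (z n)"] r by simp
    also have "\<dots> \<le> norm (\<pi> a h) * ((1 / r) * norm (\<pi> d (z n)))"
    proof (rule mult_right_mono)
      have "(norm (z n))\<^sup>2 \<le> (norm (z 0))\<^sup>2" using decseqD[OF dec, of 0 n] by simp
      then show "norm (z n) \<le> norm (\<pi> a h)" by (simp add: z_def)
    qed (use r in simp)
    finally show "norm ((norm (q n))\<^sup>2) \<le> norm (\<pi> a h) * ((1 / r) * norm (\<pi> d (z n)))" by simp
  next
    show "(\<lambda>n. norm (\<pi> a h) * ((1 / r) * norm (\<pi> d (z n)))) \<longlonglongrightarrow> 0"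
      by (intro tendsto_mult_right_zero Dz)
  qed
  then have "(\<lambda>n. norm (q n)) \<longlonglongrightarrow> 0" by simp
  then have "(\<lambda>n. norm (q (n + n))) \<longlonglongrightarrow> 0"
    using LIMSEQ_subseq_LIMSEQ[of "\<lambda>n. norm (q n)" 0 "\<lambda>n. n + n"]
    by (simp add: o_def strict_mono_def)
  then have "(\<lambda>n. norm h * norm (q (n + n))) \<longlonglongrightarrow> 0" by (rule tendsto_mult_right_zero)
  then have "\<forall>\<^sub>F n in sequentially. norm h * norm (q (n + n)) < \<epsilon>\<^sup>2"
    using assms by (intro order_tendstoD) auto
  then obtain n where n: "norm h * norm (q (n + n)) < \<epsilon>\<^sup>2"
    by (auto simp: eventually_sequentially)
  have P: "cinner (P x) y = cinner x (P y)" for x y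
    by (simp add: P_def cinner_diff_left cinner_diff_right cinner_rep_left d)
  have Pn: "cinner ((P ^^ n) x) y = cinner x ((P ^^ n) y)" for n x y
    by (induction n arbitrary: y) (simp_all add: P, simp add: funpow_swap1)
  have "cinner (z n) (z n) = cinner (\<pi> a h) (z (n + n))"
    unfolding z_def Pn by (simp add: funpow_add)
  also have "\<dots> = cinner h (q (n + n))" by (simp add: cinner_rep_left q_def)
  finally have "(norm (z n))\<^sup>2 = cmod (cinner h (q (n + n)))"
    by (metis cinner_self norm_of_real abs_of_nonneg zero_le_power2)
  also have "\<dots> \<le> norm h * norm (q (n + n))" by (rule cauchy_schwarz)
  finally have "(norm (z n))\<^sup>2 < \<epsilon>\<^sup>2" using n by linarith
  then have "norm (z n) < \<epsilon>" using assms power_less_imp_less_base by fastforce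
  then show ?thesis using e[of n] by metis
qed

text \<open>For a sum \<open>v + w\<close>, a contraction that nearly annihilates \<open>v\<close> is followed by one that nearly
  annihilates the image of \<open>w\<close>.  To make this an induction over the closed span, the vectors in question
  must be nearly annihilated also after an arbitrary \<open>1 - e0\<close> has been applied.\<close>

lemma complement_annihilates:
  assumes total: "closed_cspan M = UNIV" and M: "M \<subseteq> {\<pi> a h | a h. True}" and "\<epsilon> > 0"
  shows "\<exists>e. complement_contracts e \<and> norm (v - \<pi> e v) < \<epsilon>"
proof -
  define N where "N = {v. \<forall>e0 \<epsilon>. complement_contracts e0 \<longrightarrow> \<epsilon> > 0 \<longrightarrow>
    (\<exists>e. complement_contracts e \<and> norm ((v - \<pi> e0 v) - \<pi> e (v - \<pi> e0 v)) < \<epsilon>)}"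
  have "closed_cspan M \<subseteq> N"
  proof (rule closed_cspan_minimal)
    show "M \<subseteq> N"
    proof
      fix v assume "v \<in> M"
      then obtain a h where v: "v = \<pi> a h" using M by blast
      have "v - \<pi> e0 v = \<pi> (a - e0 * a) h" for e0
        by (simp add: v clinear_diff[OF lin] mult blinfun.diff_left)
      then show "v \<in> N" unfolding N_def using complement_annihilates_range by simp
    qed
    show "csubspace N"
    proof (rule csubspaceI)
      show "0 \<in> N" unfolding N_def using complement_contracts_zero by auto
      fix v w assume vw: "v \<in> N" "w \<in> N"
      show "v + w \<in> N" unfolding N_def
      proof (intro CollectI allI impI)
        fix e0 and \<epsilon> :: real assume e0: "complement_contracts e0" and "\<epsilon> > 0"
        let ?v = "v - \<pi> e0 v" and ?w = "w - \<pi> e0 w"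
        obtain e1 where e1: "complement_contracts e1" "norm (?v - \<pi> e1 ?v) < \<epsilon> / 2"
          using vw(1) e0 \<open>\<epsilon> > 0\<close> unfolding N_def by (auto dest!: spec[of _ e0] spec[of _ "\<epsilon> / 2"])
        let ?e1 = "e1 + e0 - e1 * e0"
        have "complement_contracts ?e1" by (rule complement_contracts_compose[OF e1(1) e0])
        then obtain e2 where e2: "complement_contracts e2"
            "norm ((w - \<pi> ?e1 w) - \<pi> e2 (w - \<pi> ?e1 w)) < \<epsilon> / 2"
          using vw(2) \<open>\<epsilon> > 0\<close> unfolding N_def by (auto dest!: spec[of _ ?e1] spec[of _ "\<epsilon> / 2"])
        let ?e = "e2 + e1 - e2 * e1"
        let ?v1 = "?v - \<pi> e1 ?v" and ?w1 = "?w - \<pi> e1 ?w"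
        have "norm (?v1 - \<pi> e2 ?v1) < \<epsilon> / 2"
          using e2(1) e1(2) unfolding complement_contracts_def by (meson order_le_less_trans)
        moreover have "norm (?w1 - \<pi> e2 ?w1) < \<epsilon> / 2"
          using e2(2) unfolding complement_apply .
        moreover have "(v + w) - \<pi> e0 (v + w) = ?v + ?w" by (simp add: blinfun.add_right)
        then have eq: "((v + w) - \<pi> e0 (v + w)) - \<pi> ?e ((v + w) - \<pi> e0 (v + w)) =
            (?v1 - \<pi> e2 ?v1) + (?w1 - \<pi> e2 ?w1)"
          unfolding complement_apply by (simp add: blinfun.add_right blinfun.diff_right)
        ultimately have "norm (((v + w) - \<pi> e0 (v + w)) - \<pi> ?e ((v + w) - \<pi> e0 (v + w))) < \<epsilon>"
          unfolding eq using norm_triangle_ineq[of "?v1 - \<pi> e2 ?v1" "?w1 - \<pi> e2 ?w1"] by linarith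
        then show "\<exists>e. complement_contracts e \<and>
            norm (((v + w) - \<pi> e0 (v + w)) - \<pi> e ((v + w) - \<pi> e0 (v + w))) < \<epsilon>"
          using complement_contracts_compose[OF e2(1) e1(1)] by blast
      qed
      fix c
      show "c *\<^sub>C v \<in> N" unfolding N_def
      proof (intro CollectI allI impI)
        fix e0 and \<epsilon> :: real assume e0: "complement_contracts e0" and "\<epsilon> > 0"
        let ?v = "v - \<pi> e0 v"
        have c: "cmod c + 1 > 0" by (simp add: add_nonneg_pos)
        then obtain e where e: "complement_contracts e" "norm (?v - \<pi> e ?v) < \<epsilon> / (cmod c + 1)"
          using vw(1) e0 \<open>\<epsilon> > 0\<close> unfolding N_def
          by (auto dest!: spec[of _ e0] spec[of _ "\<epsilon> / (cmod c + 1)"])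
        have "(c *\<^sub>C v - \<pi> e0 (c *\<^sub>C v)) - \<pi> e (c *\<^sub>C v - \<pi> e0 (c *\<^sub>C v)) = c *\<^sub>C (?v - \<pi> e ?v)"
          by (simp add: bounded_ops_scaleC[OF ops] blinfun.diff_right scaleC_diff_right)
        moreover have "cmod c * norm (?v - \<pi> e ?v) \<le> (cmod c + 1) * norm (?v - \<pi> e ?v)"
          by (intro mult_right_mono) auto
        moreover have "(cmod c + 1) * norm (?v - \<pi> e ?v) < \<epsilon>"
          using e(2) c by (simp add: field_simps)
        ultimately show "\<exists>e. complement_contracts e \<and>
            norm ((c *\<^sub>C v - \<pi> e0 (c *\<^sub>C v)) - \<pi> e (c *\<^sub>C v - \<pi> e0 (c *\<^sub>C v))) < \<epsilon>"
          using e(1) by (intro exI[of _ e]) (simp add: norm_scaleC)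
      qed
    qed
    show "closed N" unfolding closed_sequential_limits
    proof (intro allI impI, elim conjE)
      fix f v assume f: "\<forall>n. f n \<in> N" and lim: "f \<longlonglongrightarrow> v"
      show "v \<in> N" unfolding N_def
      proof (intro CollectI allI impI)
        fix e0 and \<epsilon> :: real assume e0: "complement_contracts e0" and "\<epsilon> > 0"
        then obtain n where n: "norm (f n - v) < \<epsilon> / 2"
          using LIMSEQ_D[OF lim, of "\<epsilon> / 2"] by auto
        let ?w = "f n - \<pi> e0 (f n)" and ?u = "v - f n"
        obtain e where e: "complement_contracts e" "norm (?w - \<pi> e ?w) < \<epsilon> / 2"
          using f e0 \<open>\<epsilon> > 0\<close> unfolding N_def by (auto dest!: spec[of _ n] spec[of _ e0] spec[of _ "\<epsilon> / 2"])
        let ?u1 = "?u - \<pi> e0 ?u"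
        have "norm (?u1 - \<pi> e ?u1) \<le> norm ?u"
          using e(1) e0 unfolding complement_contracts_def by (meson order_trans)
        moreover have eq: "(v - \<pi> e0 v) - \<pi> e (v - \<pi> e0 v) = (?u1 - \<pi> e ?u1) + (?w - \<pi> e ?w)"
          by (simp add: blinfun.diff_right)
        ultimately have "norm ((v - \<pi> e0 v) - \<pi> e (v - \<pi> e0 v)) < \<epsilon>"
          unfolding eq
          using e(2) n norm_triangle_ineq[of "?u1 - \<pi> e ?u1" "?w - \<pi> e ?w"] norm_minus_commute[of v "f n"]
          by linarith
        then show "\<exists>e. complement_contracts e \<and> norm ((v - \<pi> e0 v) - \<pi> e (v - \<pi> e0 v)) < \<epsilon>"
          using e(1) by blast
      qed
    qed
  qed
  then have "v \<in> N" using total by auto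
  then show ?thesis
    using complement_contracts_zero \<open>\<epsilon> > 0\<close> clinear_diff[OF lin, of 0 0]
    unfolding N_def by (auto dest!: spec[of _ 0] spec[of _ \<epsilon>])
qed

text \<open>Given \<open>w = 1 - e\<close> with \<open>w v\<close> small, the element \<open>b = 1 - (w\<^sup>* w)\<^sup>2\<close> has norm at most one, whereas \<open>e\<close>
  itself is only bounded by two.\<close>

lemma contractive_approximate_unit:
  assumes total: "closed_cspan M = UNIV" and M: "M \<subseteq> {\<pi> a h | a h. True}" and "\<epsilon> > 0"
  shows "\<exists>b. norm b \<le> 1 \<and> norm (v - \<pi> b v) < \<epsilon>"
proof -
  obtain e where e: "complement_contracts e" "norm (v - \<pi> e v) < \<epsilon>"
    using complement_annihilates[OF assms] by blast
  define g where "g = star e + e - star e * e"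
  have g: "complement_contracts g"
    unfolding g_def by (intro complement_contracts_compose complement_contracts_star e)
  have "star g = g" by (simp add: g_def star_diff star_add star_mult star_star)
  then have "norm (g + g - g * g) \<le> 1"
    using g by (intro norm_double_minus_square_le) (auto simp: complement_contracts_def)
  moreover have "norm (v - \<pi> (g + g - g * g) v) \<le> norm (v - \<pi> g v)"
    unfolding complement_apply using g by (auto simp: complement_contracts_def)
  moreover have "norm (v - \<pi> g v) \<le> norm (v - \<pi> e v)"
    unfolding g_def complement_apply
    using complement_contracts_star[OF e(1)] by (auto simp: complement_contracts_def)
  ultimately show ?thesis using e(2) by (meson order_le_less_trans order_trans)
qed

text \<open>Insert a contractive approximate unit \<open>b\<close> for \<open>V h\<close> into
  \<open>\<parallel>V h\<parallel>\<^sup>2 \<approx> \<langle>V h, \<pi>(b) V h\<rangle> = \<langle>h, V\<^sup>* \<pi>(b) V h\<rangle> \<le> \<parallel>h\<parallel>\<^sup>2\<close>.\<close>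

lemma compression_contractive_imp_contraction:
  assumes V: "V \<in> bounded_ops"
    and total: "closed_cspan {\<pi> a (blinfun_apply V h) | a h. True} = UNIV"
    and contr: "\<And>a. norm (adj V o\<^sub>L \<pi> a o\<^sub>L V) \<le> norm a"
  shows "norm (blinfun_apply V h) \<le> norm h"
proof -
  let ?v = "blinfun_apply V h"
  have bound: "(norm ?v)\<^sup>2 \<le> (norm h)\<^sup>2 + norm ?v * \<epsilon>" if pos: "\<epsilon> > 0" for \<epsilon>
  proof -
    obtain b where b: "norm b \<le> 1" "norm (?v - \<pi> b ?v) < \<epsilon>"
      using contractive_approximate_unit[OF total _ pos, of ?v] by blast
    have "cinner ?v ?v = cinner h ((adj V o\<^sub>L \<pi> b o\<^sub>L V) h) + cinner ?v (?v - \<pi> b ?v)"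
      by (simp add: cinner_adj_right[OF V] cinner_diff_right)
    then have "(norm ?v)\<^sup>2 = cmod (cinner h ((adj V o\<^sub>L \<pi> b o\<^sub>L V) h) + cinner ?v (?v - \<pi> b ?v))"
      by (metis cinner_self norm_of_real abs_of_nonneg zero_le_power2)
    also have "\<dots> \<le> norm h * norm ((adj V o\<^sub>L \<pi> b o\<^sub>L V) h) + norm ?v * norm (?v - \<pi> b ?v)"
      by (intro order_trans[OF norm_triangle_ineq] add_mono cauchy_schwarz)
    also have "norm ((adj V o\<^sub>L \<pi> b o\<^sub>L V) h) \<le> norm h"
      using norm_blinfun[of "adj V o\<^sub>L \<pi> b o\<^sub>L V" h]
        mult_right_mono[OF order_trans[OF contr b(1)], of "norm h"] by simp
    finally have "(norm ?v)\<^sup>2 \<le> norm h * norm h + norm ?v * norm (?v - \<pi> b ?v)"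
      by (simp add: mult_left_mono)
    also have "\<dots> \<le> (norm h)\<^sup>2 + norm ?v * \<epsilon>"
      using b(2) by (simp add: power2_eq_square mult_left_mono)
    finally show ?thesis .
  qed
  have "(norm ?v)\<^sup>2 \<le> (norm h)\<^sup>2"
  proof (rule field_le_epsilon)
    fix \<epsilon> :: real assume "\<epsilon> > 0"
    have pos: "norm ?v + 1 > 0" by (simp add: add_nonneg_pos)
    have "norm ?v * (\<epsilon> / (norm ?v + 1)) \<le> \<epsilon>"
      using \<open>\<epsilon> > 0\<close> pos by (simp add: field_simps)
    then show "(norm ?v)\<^sup>2 \<le> (norm h)\<^sup>2 + \<epsilon>"
      using bound[of "\<epsilon> / (norm ?v + 1)"] \<open>\<epsilon> > 0\<close> pos by fastforce
  qed
  then show ?thesis by (rule power2_le_imp_le) simp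
qed

end


section \<open>The ternary domain\<close>

locale stinespring = module_rep act ip \<pi> \<Pi>\<^sub>X
  for act :: "'x::{complex_normed_vector, complete_space} \<Rightarrow> 'a::cstar_algebra \<Rightarrow> 'x"
    and ip :: "'x \<Rightarrow> 'x \<Rightarrow> 'a"
    and \<pi> :: "'a \<Rightarrow> 'h1::complex_hilbert \<Rightarrow>\<^sub>L 'h1"
    and \<Pi>\<^sub>X :: "'x \<Rightarrow> 'h1 \<Rightarrow>\<^sub>L 'k1::complex_hilbert" +
  fixes \<phi> :: "'a \<Rightarrow> 'h::complex_hilbert \<Rightarrow>\<^sub>L 'h"
    and \<Phi> :: "'x \<Rightarrow> 'h \<Rightarrow>\<^sub>L 'k::complex_hilbert"
    and V :: "'h \<Rightarrow>\<^sub>L 'h1"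
    and W :: "'k \<Rightarrow>\<^sub>L 'k1"
  assumes V_ops: "V \<in> bounded_ops" and W_coisometry: "coisometry W"
    and phi: "\<phi> a = adj V o\<^sub>L \<pi> a o\<^sub>L V"
    and Phi: "\<Phi> x = adj W o\<^sub>L \<Pi>\<^sub>X x o\<^sub>L V"
    and total_V: "closed_cspan {blinfun_apply (\<pi> a) (blinfun_apply V h) | a h. True} = UNIV"
begin

lemma W_ops: "W \<in> bounded_ops"
  using W_coisometry by (simp add: coisometry_def)

lemma W_adj_W: "W (adj W k) = k"
proof -
  have "W o\<^sub>L adj W = id_blinfun" using W_coisometry by (simp add: coisometry_def)
  from arg_cong[OF this, of "\<lambda>f. blinfun_apply f k"] show ?thesis by simp
qed

lemma adj_W_cancel: "adj W k = adj W k' \<longleftrightarrow> k = k'"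
  by (metis W_adj_W)

lemma V_ops': "adj V \<in> bounded_ops"
  by (rule adj_in_bounded_ops[OF V_ops])

lemma phi_apply: "\<phi> a h = adj V (\<pi> a (V h))"
  by (simp add: phi)

lemma Phi_apply: "\<Phi> x h = adj W (\<Pi>\<^sub>X x (V h))"
  by (simp add: Phi)

lemma adj_Phi_apply: "adj (\<Phi> x) k = adj V (adj (\<Pi>\<^sub>X x) (W k))"
proof -
  have "adj (\<Phi> x) = adj V o\<^sub>L adj (\<Pi>\<^sub>X x) o\<^sub>L W"
    by (rule adj_eqI)
       (simp add: Phi_apply cinner_adj_left[OF W_ops] cinner_adj_right[OF V_ops] cinner_adj_right[OF map_ops])
  then show ?thesis by simp
qed

lemma induced_rep_apply:
  "T \<in> compact_ops act ip \<Longrightarrow> induced_rep act ip \<Pi>\<^sub>X W T k = adj W (compact_action T (W k))"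
  by (simp add: induced_rep_eq[OF W_coisometry])

lemma induced_rep_rank_one:
  "induced_rep act ip \<Pi>\<^sub>X W (rank_one_op act ip x y) k = adj W (\<Pi>\<^sub>X x (adj (\<Pi>\<^sub>X y) (W k)))"
  by (simp add: induced_rep_apply rank_one_compact compact_action_eq[OF implements_rank_one])

lemma Phi_compact:
  assumes "T \<in> compact_ops act ip"
  shows "\<Phi> (T z) = induced_rep act ip \<Pi>\<^sub>X W T o\<^sub>L \<Phi> z"
  using implements_compact_action[OF assms]
  by (intro blinfun_eqI)
     (simp add: induced_rep_apply[OF assms] Phi_apply W_adj_W implements_def)

lemma ops_eq_on_rep_range:
  assumes "S \<in> bounded_ops" "T \<in> bounded_ops" "\<And>a h. S (\<pi> a (V h)) = T (\<pi> a (V h))"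
  shows "S = T"
  by (rule bounded_ops_eq_on_total[OF total_V assms(1,2)]) (use assms(3) in auto)

text \<open>Both sides of \<open>\<Phi>(x b) = \<Phi>(x) \<phi>(b)\<close> are \<open>W\<^sup>*\<close> applied to an operator on \<open>\<pi>(b) V h\<close>; such vectors are
  total and \<open>W\<^sup>*\<close> is injective.\<close>

lemma ternary_domain_iff:
  "x \<in> ternary_domain act \<phi> \<Phi> \<longleftrightarrow> (\<forall>k. \<Pi>\<^sub>X x k = \<Pi>\<^sub>X x (V (adj V k)))"
proof
  assume x: "x \<in> ternary_domain act \<phi> \<Phi>"
  have "\<Pi>\<^sub>X x = \<Pi>\<^sub>X x o\<^sub>L V o\<^sub>L adj V"
  proof (rule ops_eq_on_rep_range)
    fix b h
    have "\<Phi> (act x b) h = \<Phi> x (\<phi> b h)"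
      using x by (simp add: ternary_domain_def)
    then show "\<Pi>\<^sub>X x (\<pi> b (V h)) = (\<Pi>\<^sub>X x o\<^sub>L V o\<^sub>L adj V) (\<pi> b (V h))"
      by (simp add: Phi_apply phi_apply map_act adj_W_cancel)
  qed (intro compose_in_bounded_ops map_ops V_ops V_ops')+
  from arg_cong[OF this, of blinfun_apply]
  show "\<forall>k. \<Pi>\<^sub>X x k = \<Pi>\<^sub>X x (V (adj V k))" by (simp add: fun_eq_iff)
next
  assume x: "\<forall>k. \<Pi>\<^sub>X x k = \<Pi>\<^sub>X x (V (adj V k))"
  have "\<Phi> (act x b) h = (\<Phi> x o\<^sub>L \<phi> b) h" for b h
    using x[rule_format, of "\<pi> b (V h)"] by (simp add: Phi_apply phi_apply map_act)
  then show "x \<in> ternary_domain act \<phi> \<Phi>"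
    by (auto simp: ternary_domain_def intro: blinfun_eqI)
qed

lemma compact_ternary_domain:
  assumes T: "T \<in> compact_ops act ip" and x: "x \<in> ternary_domain act \<phi> \<Phi>"
  shows "T x \<in> ternary_domain act \<phi> \<Phi>"
proof -
  have T_map: "\<Pi>\<^sub>X (T x) k = compact_action T (\<Pi>\<^sub>X x k)" for k
    using implements_compact_action[OF T] by (simp add: implements_def)
  show ?thesis using x unfolding ternary_domain_iff T_map by metis
qed

lemma induced_rep_ternary_domain:
  assumes "x \<in> ternary_domain act \<phi> \<Phi>"
  shows "induced_rep act ip \<Pi>\<^sub>X W (rank_one_op act ip x y) = \<Phi> x o\<^sub>L adj (\<Phi> y)"
  using assms unfolding ternary_domain_iff
  by (intro blinfun_eqI) (simp add: induced_rep_rank_one Phi_apply adj_Phi_apply)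

text \<open>Comparing the two sides on \<open>v = \<Pi>(x)\<^sup>* k\<close> gives \<open>\<parallel>v\<parallel> = \<parallel>V\<^sup>* v\<parallel>\<close>.  Since \<open>V\<close> is a contraction, equality
  holds only if \<open>V V\<^sup>* v = v\<close>.\<close>

lemma ternary_domain_if_induced_rep:
  assumes contr: "\<And>a. norm (\<phi> a) \<le> norm a"
    and eq: "induced_rep act ip \<Pi>\<^sub>X W (rank_one_op act ip x x) = \<Phi> x o\<^sub>L adj (\<Phi> x)"
  shows "x \<in> ternary_domain act \<phi> \<Phi>"
proof -
  have V: "norm (V h) \<le> norm h" for h
    by (rule compression_contractive_imp_contraction[OF V_ops total_V]) (use contr phi in simp)
  have fix_adj: "V (adj V (adj (\<Pi>\<^sub>X x) k)) = adj (\<Pi>\<^sub>X x) k" for k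
  proof -
    let ?v = "adj (\<Pi>\<^sub>X x) k"
    have "adj W (\<Pi>\<^sub>X x (adj (\<Pi>\<^sub>X x) (W (adj W k)))) = adj W (\<Pi>\<^sub>X x (V (adj V (adj (\<Pi>\<^sub>X x) (W (adj W k))))))"
      using arg_cong[OF eq, of "\<lambda>f. blinfun_apply f (adj W k)"]
      by (simp add: induced_rep_rank_one Phi_apply adj_Phi_apply)
    then have "\<Pi>\<^sub>X x ?v = \<Pi>\<^sub>X x (V (adj V ?v))" by (simp add: adj_W_cancel W_adj_W)
    then have "cinner k (\<Pi>\<^sub>X x ?v) = cinner k (\<Pi>\<^sub>X x (V (adj V ?v)))" by simp
    then have "cinner ?v ?v = cinner (adj V ?v) (adj V ?v)"
      by (simp add: cinner_adj_left[OF map_ops, symmetric] cinner_adj_left[OF V_ops])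
    from arg_cong[OF this, of Re] have "(norm ?v)\<^sup>2 = (norm (adj V ?v))\<^sup>2"
      by (simp add: cinner_self flip: of_real_power)
    moreover have "Re (cinner ?v (V (adj V ?v))) = (norm (adj V ?v))\<^sup>2"
      using cinner_adj_left[OF V_ops, of ?v "adj V ?v", symmetric]
      by (simp add: cinner_self flip: of_real_power)
    moreover have "(norm (V (adj V ?v)))\<^sup>2 \<le> (norm (adj V ?v))\<^sup>2"
      by (rule power_mono[OF V]) simp
    ultimately have "(norm (?v - V (adj V ?v)))\<^sup>2 \<le> 0"
      unfolding norm_diff_square by linarith
    then show ?thesis by simp
  qed
  show ?thesis unfolding ternary_domain_iff
  proof (intro allI cinner_eq_right)
    fix k h
    have "cinner h (\<Pi>\<^sub>X x (V (adj V k))) = cinner (V (adj V (adj (\<Pi>\<^sub>X x) h))) k"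
      by (simp add: cinner_adj_left[OF map_ops, symmetric] cinner_adj_left[OF V_ops, symmetric]
          cinner_adj_right[OF V_ops])
    then show "cinner h (\<Pi>\<^sub>X x k) = cinner h (\<Pi>\<^sub>X x (V (adj V k)))"
      by (simp add: fix_adj cinner_adj_left[OF map_ops])
  qed
qed

text \<open>With \<open>R = V V\<^sup>*\<close>, cancelling total sets on both sides turns the ternary condition into
  \<open>\<pi>(a) = R \<pi>(a) R\<close>, and the two multiplicativity conditions into \<open>V\<^sup>* \<pi>(a) = V\<^sup>* \<pi>(a) R\<close> and
  \<open>\<pi>(a) V = R \<pi>(a) V\<close>.  Multiplying these by \<open>V\<close> and \<open>V\<^sup>*\<close> gives \<open>R \<pi>(a) = R \<pi>(a) R = \<pi>(a) R\<close>.\<close>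

lemma ternary_mult_domain_rep:
  assumes a: "a \<in> ternary_mult_domain \<phi>"
  shows "V (adj V (\<pi> a k)) = \<pi> a k" "\<pi> a (V (adj V k)) = \<pi> a k"
proof -
  have mult_left: "\<phi> (a * b) = \<phi> a o\<^sub>L \<phi> b" and mult_right: "\<phi> (b * a) = \<phi> b o\<^sub>L \<phi> a"
    and tern: "\<phi> (b * star a * c) = \<phi> b o\<^sub>L adj (\<phi> a) o\<^sub>L \<phi> c" for b c
    using a by (auto simp: ternary_mult_domain_def mult_domain_def)
  note ops_intros = compose_in_bounded_ops adj_in_bounded_ops ops V_ops V_ops'
  have cancel_left: "u = v" if "\<And>b. adj V (\<pi> b u) = adj V (\<pi> b v)" for u v
  proof (rule cinner_eq_on_total[OF total_V])
    fix s assume "s \<in> {\<pi> a (V h) | a h. True}"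
    then obtain b h where s: "s = \<pi> b (V h)" by blast
    show "cinner s u = cinner s v"
      using arg_cong[OF that[of "star b"], of "cinner h"]
      by (simp add: s cinner_rep_left cinner_adj_right[OF V_ops])
  qed
  have adj_phi: "adj (\<phi> a) h = adj V (\<pi> (star a) (V h))" for h
  proof -
    have "adj (\<phi> a) = \<phi> (star a)"
      by (rule adj_eqI)
         (simp add: phi_apply cinner_adj_left[OF V_ops] cinner_adj_right[OF V_ops] cinner_rep_left)
    then show ?thesis by (simp add: phi_apply)
  qed
  have "\<pi> (star a) = V o\<^sub>L adj V o\<^sub>L \<pi> (star a) o\<^sub>L V o\<^sub>L adj V"
  proof (rule ops_eq_on_rep_range)
    fix c h
    show "\<pi> (star a) (\<pi> c (V h)) = (V o\<^sub>L adj V o\<^sub>L \<pi> (star a) o\<^sub>L V o\<^sub>L adj V) (\<pi> c (V h))"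
    proof (rule cancel_left)
      fix b
      show "adj V (\<pi> b (\<pi> (star a) (\<pi> c (V h)))) =
          adj V (\<pi> b ((V o\<^sub>L adj V o\<^sub>L \<pi> (star a) o\<^sub>L V o\<^sub>L adj V) (\<pi> c (V h))))"
        using arg_cong[OF tern[of b c], of "\<lambda>f. blinfun_apply f h"]
        by (simp add: phi_apply adj_phi mult)
    qed
  qed (intro ops_intros)+
  then have star_a: "\<pi> (star a) k = V (adj V (\<pi> (star a) (V (adj V k))))" for k
    by (metis blinfun_apply_blinfun_compose)
  have sandwich: "\<pi> a k = V (adj V (\<pi> a (V (adj V k))))" for k
  proof (rule cinner_eq_right)
    fix z
    have "cinner z (\<pi> a k) = cinner (V (adj V (\<pi> (star a) (V (adj V z))))) k"
      by (simp add: cinner_rep_right flip: star_a)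
    then show "cinner z (\<pi> a k) = cinner z (V (adj V (\<pi> a (V (adj V k)))))"
      by (simp add: cinner_rep_right cinner_adj_left[OF V_ops, symmetric] cinner_adj_right[OF V_ops])
  qed
  have "adj V o\<^sub>L \<pi> a = adj V o\<^sub>L \<pi> a o\<^sub>L V o\<^sub>L adj V"
  proof (rule ops_eq_on_rep_range)
    fix c h
    show "(adj V o\<^sub>L \<pi> a) (\<pi> c (V h)) = (adj V o\<^sub>L \<pi> a o\<^sub>L V o\<^sub>L adj V) (\<pi> c (V h))"
      using arg_cong[OF mult_left[of c], of "\<lambda>f. blinfun_apply f h"] by (simp add: phi_apply mult)
  qed (intro ops_intros)+
  then have "adj V (\<pi> a k) = adj V (\<pi> a (V (adj V k)))" for k
    by (metis blinfun_apply_blinfun_compose)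
  then show "V (adj V (\<pi> a k)) = \<pi> a k" by (metis sandwich)
  have range: "\<pi> a (V h) = V (adj V (\<pi> a (V h)))" for h
  proof (rule cancel_left)
    show "adj V (\<pi> b (\<pi> a (V h))) = adj V (\<pi> b (V (adj V (\<pi> a (V h)))))" for b
      using arg_cong[OF mult_right[of b], of "\<lambda>f. blinfun_apply f h"] by (simp add: phi_apply mult)
  qed
  then show "\<pi> a (V (adj V k)) = \<pi> a k" by (metis sandwich)
qed

lemma act_ternary_mult_domain:
  assumes "a \<in> ternary_mult_domain \<phi>"
  shows "act x a \<in> ternary_domain act \<phi> \<Phi>" "\<Phi> (act x a) = \<Phi> x o\<^sub>L \<phi> a"
proof -
  show "act x a \<in> ternary_domain act \<phi> \<Phi>"
    unfolding ternary_domain_iff by (simp add: map_act ternary_mult_domain_rep[OF assms])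
  show "\<Phi> (act x a) = \<Phi> x o\<^sub>L \<phi> a"
    by (rule blinfun_eqI) (simp add: Phi_apply phi_apply map_act ternary_mult_domain_rep[OF assms])
qed

end

lemma minimal_stinespring_imp_stinespring:
  assumes "hilbert_module act ip" "minimal_stinespring ip \<phi> \<Phi> \<pi> \<Pi>\<^sub>X V W"
  shows "stinespring act ip \<pi> \<Pi>\<^sub>X \<phi> \<Phi> V W"
proof -
  note ms = assms(2)[unfolded minimal_stinespring_def]
  interpret hilbert_module act ip by (rule assms(1))
  have "{\<Pi>\<^sub>X x (V h) | x h. True} \<subseteq> {\<Pi>\<^sub>X x h | x h. True}" by blast
  then have "closed_cspan {\<Pi>\<^sub>X x (V h) | x h. True} \<subseteq> closed_cspan {\<Pi>\<^sub>X x h | x h. True}"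
    by (intro closed_cspan_minimal[OF order_trans[OF _ closed_cspan_superset]]
        csubspace_closed_cspan closed_closed_cspan)
  then have "closed_cspan {\<Pi>\<^sub>X x h | x h. True} = UNIV" using ms by auto
  then show ?thesis
    using ms by unfold_locales auto
qed

theorem lemma5p2:
  fixes act :: "'x::{complex_normed_vector, complete_space} \<Rightarrow> 'a::cstar_algebra \<Rightarrow> 'x"
    and ip :: "'x \<Rightarrow> 'x \<Rightarrow> 'a"
    and \<phi> :: "'a \<Rightarrow> 'h::complex_hilbert \<Rightarrow>\<^sub>L 'h"
    and \<Phi> :: "'x \<Rightarrow> 'h \<Rightarrow>\<^sub>L 'k::complex_hilbert"
    and \<pi> :: "'a \<Rightarrow> 'h1::complex_hilbert \<Rightarrow>\<^sub>L 'h1"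
    and \<Pi>\<^sub>X :: "'x \<Rightarrow> 'h1 \<Rightarrow>\<^sub>L 'k1::complex_hilbert"
    and V :: "'h \<Rightarrow>\<^sub>L 'h1"
    and W :: "'k \<Rightarrow>\<^sub>L 'k1"
  assumes "hilbert_module act ip"
    and "completely_positive \<phi>"
    and "op_valued_map ip \<phi> \<Phi>"
    and "minimal_stinespring ip \<phi> \<Phi> \<pi> \<Pi>\<^sub>X V W"
  shows "let \<psi> = induced_rep act ip \<Pi>\<^sub>X W;
             \<theta> = rank_one_op act ip;
             X\<^sub>\<phi> = ternary_domain act \<phi> \<Phi>
         in (\<forall>T\<in>compact_ops act ip. \<forall>z. \<Phi> (blinfun_apply T z) = \<psi> T o\<^sub>L \<Phi> z) \<and>
            {blinfun_apply T x | T x. T \<in> compact_ops act ip \<and> x \<in> X\<^sub>\<phi>} \<subseteq> X\<^sub>\<phi> \<and>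
            ((\<forall>a. norm (\<phi> a) \<le> norm a) \<longrightarrow>
               (\<forall>x. x \<in> X\<^sub>\<phi> \<longleftrightarrow> \<psi> (\<theta> x x) = \<Phi> x o\<^sub>L adj (\<Phi> x)) \<and>
               (\<forall>x. x \<in> X\<^sub>\<phi> \<longleftrightarrow> (\<forall>y. \<psi> (\<theta> x y) = \<Phi> x o\<^sub>L adj (\<Phi> y))) \<and>
               (\<forall>x y. \<forall>a\<in>ternary_mult_domain \<phi>.
                  \<psi> (\<theta> (act x a) y) = \<Phi> (act x a) o\<^sub>L adj (\<Phi> y) \<and>
                  \<Phi> (act x a) o\<^sub>L adj (\<Phi> y) = \<Phi> x o\<^sub>L \<phi> a o\<^sub>L adj (\<Phi> y)))"
proof -
  interpret stinespring act ip \<pi> \<Pi>\<^sub>X \<phi> \<Phi> V W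
    using assms by (intro minimal_stinespring_imp_stinespring)
  let ?\<psi> = "induced_rep act ip \<Pi>\<^sub>X W"
  let ?\<theta> = "rank_one_op act ip"
  let ?X = "ternary_domain act \<phi> \<Phi>"
  show ?thesis
    unfolding Let_def
  proof (intro conjI impI allI ballI)
    show "\<Phi> (blinfun_apply T z) = ?\<psi> T o\<^sub>L \<Phi> z" if "T \<in> compact_ops act ip" for T z
      using that by (rule Phi_compact)
    show "{blinfun_apply T x | T x. T \<in> compact_ops act ip \<and> x \<in> ?X} \<subseteq> ?X"
      using compact_ternary_domain by auto
    assume contr: "\<forall>a. norm (\<phi> a) \<le> norm a"
    show "x \<in> ?X \<longleftrightarrow> ?\<psi> (?\<theta> x x) = \<Phi> x o\<^sub>L adj (\<Phi> x)" for x
      using induced_rep_ternary_domain ternary_domain_if_induced_rep[OF contr[rule_format]] by blast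
    show "x \<in> ?X \<longleftrightarrow> (\<forall>y. ?\<psi> (?\<theta> x y) = \<Phi> x o\<^sub>L adj (\<Phi> y))" for x
      using induced_rep_ternary_domain ternary_domain_if_induced_rep[OF contr[rule_format]] by blast
    fix x y a assume a: "a \<in> ternary_mult_domain \<phi>"
    show "?\<psi> (?\<theta> (act x a) y) = \<Phi> (act x a) o\<^sub>L adj (\<Phi> y)"
      by (rule induced_rep_ternary_domain[OF act_ternary_mult_domain(1)[OF a]])
    show "\<Phi> (act x a) o\<^sub>L adj (\<Phi> y) = \<Phi> x o\<^sub>L \<phi> a o\<^sub>L adj (\<Phi> y)"
      by (simp add: act_ternary_mult_domain(2)[OF a])
  qed
qed

end
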